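(* Fix integers $n,d\ge 1$, constants $0<h_{min}<h_{max}$, any initial state $\mathcal{X}^{(0)}\in\mathbb{R}^{dn}$, an initial bandwidth $h_1\in[h_{min},h_{max}]$, and a non-negative sequence $(\nu_k)$ with $\nu_k\to 0$. Let $(\mathcal{X}^{(k)})$, $\mathcal{X}^{(k)}=[\mathbf{x}_1^{(k)},\ldots,\mathbf{x}_n^{(k)}]$, be generated by the Doubly Stochastic Mean-Shift (DSMS) process described in the context, and let $\tau$ be a real number with $0<\tau<h_{min}/2$. Then almost surely there exist a partition $J_1,\ldots,J_M$ of $\{1,\ldots,n\}$ and an integer $K$ such that for every $k\ge K$: 1) for all $l\in[M]$, $\max_{i,j\in J_l}\|\mathbf{x}_i^{(k)}-\mathbf{x}_j^{(k)}\|<\tau$; 2) for all $l\ne m$ in $[M]$, $\min_{i\in J_l,\,j\in J_m}\|\mathbf{x}_i^{(k)}-\mathbf{x}_j^{(k)}\|>h_{min}-\tau$. That is, almost surely the points belong to fixed clusters $\mathcal{C}_l=\{\mathbf{x}_i^{(k)}: i\in J_l\}$ for all sufficiently large $k$. Moreover, almost surely the diameters of all clusters tend to $0$ as $k\to\infty$.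
   Context: A profile function is a map $k:[0,\infty)\to\mathbb{R}_+$ that vanishes on $[1,\infty)$, is $C^1$, non-increasing and convex, with $k'(t)<0$ for all $t\in[0,1)$. The associated kernel is $K(\mathbf{u})=k(\|\mathbf{u}\|^2)$ on $\mathbb{R}^d$ and the weight function is $G(\mathbf{u})=-k'(\|\mathbf{u}\|^2)$; $\|\cdot\|$ is the Euclidean norm. A state is $\mathcal{X}=[\mathbf{x}_1,\ldots,\mathbf{x}_n]\in\mathbb{R}^{dn}$, $\mathbf{x}_i\in\mathbb{R}^d$. Mean-shift operator for $h>0$: $\mathcal{S}_h(x;\mathcal{X})=\sum_{i=1}^n G((x-\mathbf{x}_i)/h)\mathbf{x}_i\big/\sum_{i=1}^n G((x-\mathbf{x}_i)/h)$. DSMS process: for $k=0,1,2,\ldots$: if $k\ge1$, set $\delta_k=\min\{\nu_k,\ (h_k/h_{min})^2-1,\ 1-(h_k/h_{max})^2\}$, draw $\alpha_k$ uniformly on $(1-\delta_k,1+\delta_k)$ (with $\alpha_k=1$ if $\delta_k=0$), and set $h_{k+1}=h_k/\sqrt{\alpha_k}$ (so $h_{k+1}\in[h_{min},h_{max}]$); draw $i_k$ uniformly from $\{1,\ldots,n\}$; set $\mathbf{x}_{i_k}^{(k+1)}=\mathcal{S}_{h_{k+1}}(\mathbf{x}_{i_k}^{(k)};\mathcal{X}^{(k)})$ and $\mathbf{x}_j^{(k+1)}=\mathbf{x}_j^{(k)}$ for $j\ne i_k$. The indices $i_k$ are i.i.d., independent of all previous choices, and $(i_k)$, $(h_k)$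 are independent. *)

theory Defs
  imports "HOL-Probability.Probability" "HOL-Library.Disjoint_Sets"
begin

definition profile :: "(real \<Rightarrow> real) \<Rightarrow> (real \<Rightarrow> real) \<Rightarrow> bool" where
  "profile k k' \<longleftrightarrow>
     (\<forall>t\<ge>0. k t \<ge> 0) \<and>
     (\<forall>t\<ge>1. k t = 0) \<and>
     (\<forall>t\<ge>0. (k has_real_derivative k' t) (at t within {0..})) \<and>
     continuous_on {0..} k' \<and>
     (\<forall>s t. 0 \<le> s \<longrightarrow> s \<le> t \<longrightarrow> k t \<le> k s) \<and>
     convex_on {0..} k \<and>
     (\<forall>t. 0 \<le> t \<longrightarrow> t < 1 \<longrightarrow> k' t < 0)"

definition weightG :: "(real \<Rightarrow> real) \<Rightarrow> 'a::euclidean_space \<Rightarrow> real" where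
  "weightG k' u = - k' ((norm u)\<^sup>2)"

text \<open>Mean-shift operator; a state is a map from indices {..<n} (0-based) to points.\<close>
definition mean_shift :: "(real \<Rightarrow> real) \<Rightarrow> nat \<Rightarrow> real \<Rightarrow> 'a::euclidean_space \<Rightarrow> (nat \<Rightarrow> 'a) \<Rightarrow> 'a" where
  "mean_shift k' n h x X =
     (1 / (\<Sum>i<n. weightG k' ((1/h) *\<^sub>R (x - X i)))) *\<^sub>R
       (\<Sum>i<n. weightG k' ((1/h) *\<^sub>R (x - X i)) *\<^sub>R X i)"

text \<open>Bandwidths: dsms_h ... m = h_{m+1}. The random factor is
  alpha_k = 1 + delta_k * u_k with u_k uniform on (-1,1), i.e. alpha_k uniform on
  (1-delta_k, 1+delta_k) (and alpha_k = 1 when delta_k = 0).\<close>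
fun dsms_h :: "real \<Rightarrow> real \<Rightarrow> (nat \<Rightarrow> real) \<Rightarrow> real \<Rightarrow> (nat \<Rightarrow> real) \<Rightarrow> nat \<Rightarrow> real" where
  "dsms_h hmin hmax \<nu> h1 u 0 = h1"
| "dsms_h hmin hmax \<nu> h1 u (Suc m) =
     (let h = dsms_h hmin hmax \<nu> h1 u m;
          \<delta> = min (\<nu> (Suc m)) (min ((h / hmin)\<^sup>2 - 1) (1 - (h / hmax)\<^sup>2));
          \<alpha> = 1 + \<delta> * u (Suc m)
      in h / sqrt \<alpha>)"

text \<open>States: dsms_x ... k = X^(k); step k updates index i_k with bandwidth h_{k+1}.\<close>
fun dsms_x :: "(real \<Rightarrow> real) \<Rightarrow> nat \<Rightarrow> real \<Rightarrow> real \<Rightarrow> (nat \<Rightarrow> real) \<Rightarrow> real \<Rightarrow>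
      (nat \<Rightarrow> 'a::euclidean_space) \<Rightarrow> (nat \<Rightarrow> nat) \<Rightarrow> (nat \<Rightarrow> real) \<Rightarrow> nat \<Rightarrow> nat \<Rightarrow> 'a" where
  "dsms_x k' n hmin hmax \<nu> h1 X0 i u 0 = X0"
| "dsms_x k' n hmin hmax \<nu> h1 X0 i u (Suc k) =
     (let X = dsms_x k' n hmin hmax \<nu> h1 X0 i u k
      in X(i k := mean_shift k' n (dsms_h hmin hmax \<nu> h1 u k) (X (i k)) X))"

end

theory Submission
  imports Defs
begin

text \<open>
  Write \<open>s = 1/h\<^sup>2\<close> and let \<open>\<Phi>(s, X) = \<Sum>a b. k (s |x_a - x_b|\<^sup>2)\<close>. Since \<open>k\<close> is convex, a
  mean-shift step with bandwidth \<open>h\<close> raises \<open>\<Phi>(s, \<cdot>)\<close> by at least a constant times the squared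
  displacement of the moved point; and \<open>\<Phi>\<close> is convex in \<open>s\<close>, while the random factor \<open>\<alpha>\<close> has mean 1,
  so changing the bandwidth does not lower \<open>\<Phi>\<close> in expectation. As \<open>\<Phi>\<close> is bounded and the index
  is uniform, the expected squared displacements that all points \<^emph>\<open>would\<close> undergo are summable, hence
  almost surely these displacements tend to 0. Their weighted sum tested against the points
  themselves is, by symmetry of the weights, the Dirichlet form \<open>\<Sum>a b. w_ab |x_a - x_b|\<^sup>2 / 2\<close>, so
  this tends to 0 as well: eventually every distance is either close to 0 or at least about \<open>h_min\<close>,
  and as the steps are small no pair can change from one regime to the other.
\<close>

section \<open>Profiles\<close>

text \<open>Convexity gives the tangent inequality only at interior points of \<open>{0..}\<close>.
  At the endpoint \<open>t = 0\<close> it follows by letting \<open>t\<close> decrease to 0, since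
  \<open>k\<close> and \<open>k'\<close> are continuous; the closure argument treats all
  \<open>t\<close> at once.\<close>

lemma profile_above_tangent:
  assumes "profile k k'" "0 \<le> s" "0 \<le> t"
  shows "k t + k' t * (s - t) \<le> k s"
proof -
  have der: "(k has_real_derivative k' t) (at t within {0..})" if "t \<ge> 0" for t
    using assms(1) that by (auto simp: profile_def)
  have cvx: "convex_on {0..} k" and ck': "continuous_on {0..} k'"
    using assms(1) by (auto simp: profile_def)
  have ck: "continuous_on {0..} k"
    using der by (intro DERIV_continuous_on) auto
  have cl: "closure {0<..} = {0::real..}"
    by (rule closure_greaterThan)
  have "0 \<le> k s - k t - k' t * (s - t)"
  proof (rule continuous_ge_on_closure[where S = "{0<..}" and x = t])
    show "continuous_on (closure {0<..}) (\<lambda>t. k s - k t - k' t * (s - t))"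
      unfolding cl by (intro continuous_intros ck ck')
    show "t \<in> closure {0<..}"
      unfolding cl using assms by simp
    show "0 \<le> k s - k t - k' t * (s - t)" if "t \<in> {0<..}" for t
      using convex_on_imp_above_tangent[OF cvx _ _ _ der, of t s] that assms(2)
      by (auto simp: is_interval_connected)
  qed
  then show ?thesis by simp
qed

lemma profile_deriv_nonpos:
  assumes "profile k k'" "0 \<le> t"
  shows "k' t \<le> 0"
  using profile_above_tangent[OF assms(1), of "t + 1" t] assms
  by (force simp: profile_def)

text \<open>Adding the tangent inequalities at \<open>s\<close> and at \<open>t\<close>, each
  evaluated at the other point, cancels the values of \<open>k\<close>.\<close>

lemma profile_deriv_mono:
  assumes "profile k k'" "0 \<le> s" "s \<le> t"
  shows "k' s \<le> k' t"
proof (cases "s = t")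
  case False
  have "(k' s - k' t) * (t - s) \<le> 0"
    using profile_above_tangent[OF assms(1), of s t] profile_above_tangent[OF assms(1), of t s] assms
    by (simp add: algebra_simps)
  then show ?thesis using False assms(3) by (simp add: mult_le_0_iff)
qed simp

lemma profile_le_at_0:
  assumes "profile k k'" "0 \<le> t"
  shows "0 \<le> k t" "k t \<le> k 0"
  using assms by (auto simp: profile_def)

section \<open>Mean shift\<close>

lemma weightG_scaled_diff:
  "weightG k' ((1/h) *\<^sub>R (x - y)) = - k' ((1/h\<^sup>2) * (dist x y)\<^sup>2)"
  by (simp add: weightG_def dist_norm power_mult_distrib power_divide)

lemma weightG_nonneg: "profile k k' \<Longrightarrow> 0 \<le> weightG k' u"
  using profile_deriv_nonpos[of k k'] by (simp add: weightG_def)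

lemma weightG_le: "profile k k' \<Longrightarrow> weightG k' u \<le> - k' 0"
  using profile_deriv_mono[of k k' 0 "(norm u)\<^sup>2"] by (simp add: weightG_def)

text \<open>Each point carries weight \<open>- k' 0 > 0\<close> with respect to itself, so the
  denominator of the mean-shift operator never vanishes at a point of the state.\<close>

lemma sum_weightG_pos:
  fixes n :: nat
  assumes "profile k k'" "i < n"
  shows "0 < (\<Sum>j<n. weightG k' ((1/h) *\<^sub>R (X i - X j)))"
proof -
  have "0 < weightG k' ((1/h) *\<^sub>R (X i - X i))"
    using assms(1) by (simp add: weightG_def profile_def)
  also have "\<dots> \<le> (\<Sum>j<n. weightG k' ((1/h) *\<^sub>R (X i - X j)))"
    using assms weightG_nonneg[OF assms(1)]
    by (intro member_le_sum[where f = "\<lambda>j. weightG k' ((1/h) *\<^sub>R (X i - X j))"]) auto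
  finally show ?thesis .
qed

text \<open>The denominator may be cleared because the total weight is positive. Both the energy
  estimate and the summation by parts use the operator through this identity.\<close>

lemma mean_shift_balance:
  assumes "profile k k'" "i < n"
  shows "(\<Sum>j<n. weightG k' ((1/h) *\<^sub>R (X i - X j))) *\<^sub>R (mean_shift k' n h (X i) X - X i)
    = (\<Sum>j<n. weightG k' ((1/h) *\<^sub>R (X i - X j)) *\<^sub>R (X j - X i))"
  using sum_weightG_pos[OF assms, of h X]
  by (simp add: mean_shift_def scaleR_diff_right sum_subtractf scaleR_sum_left)

text \<open>The image is a convex combination of the points of the state, so balls around the origin
  are invariant.\<close>

lemma norm_mean_shift_le:
  assumes "profile k k'" "i < n" "\<And>j. j < n \<Longrightarrow> norm (X j) \<le> B"
  shows "norm (mean_shift k' n h (X i) X) \<le> B"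
proof -
  define w where "w j = weightG k' ((1/h) *\<^sub>R (X i - X j))" for j
  have w: "0 \<le> w j" for j unfolding w_def by (rule weightG_nonneg[OF assms(1)])
  have W: "0 < (\<Sum>j<n. w j)" unfolding w_def by (rule sum_weightG_pos[OF assms(1,2)])
  have "norm (\<Sum>j<n. w j *\<^sub>R X j) \<le> (\<Sum>j<n. w j * B)"
    using w assms(3) by (intro sum_norm_le) (auto intro: mult_left_mono)
  also have "\<dots> = (\<Sum>j<n. w j) * B" by (simp add: sum_distrib_right)
  finally show ?thesis
    using W unfolding mean_shift_def w_def[symmetric] by (simp add: field_simps)
qed

text \<open>Row and column \<open>i\<close> contribute equally by symmetry, and their common entry
  is 0. A step that moves only point \<open>i\<close> changes only the distances in this row and
  column.\<close>

lemma sum_sum_supported_cross: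
  fixes f :: "nat \<Rightarrow> nat \<Rightarrow> real"
  assumes "i < n" "\<And>a b. f a b = f b a" "f i i = 0"
    and "\<And>a b. a \<noteq> i \<Longrightarrow> b \<noteq> i \<Longrightarrow> f a b = 0"
  shows "(\<Sum>a<n. \<Sum>b<n. f a b) = 2 * (\<Sum>b<n. f i b)"
proof -
  have "(\<Sum>a<n. \<Sum>b<n. f a b) = (\<Sum>b<n. f i b) + (\<Sum>a\<in>{..<n}-{i}. \<Sum>b<n. f a b)"
    using assms(1) by (subst sum.remove[of _ i]) auto
  also have "(\<Sum>a\<in>{..<n}-{i}. \<Sum>b<n. f a b) = (\<Sum>a\<in>{..<n}-{i}. f a i)"
  proof (rule sum.cong[OF refl])
    fix a assume a: "a \<in> {..<n}-{i}"
    have "(\<Sum>b<n. f a b) = f a i + (\<Sum>b\<in>{..<n}-{i}. f a b)"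
      using assms(1) by (subst sum.remove[of _ i]) auto
    also have "(\<Sum>b\<in>{..<n}-{i}. f a b) = 0"
      using a assms(4) by (intro sum.neutral) auto
    finally show "(\<Sum>b<n. f a b) = f a i" by simp
  qed
  also have "\<dots> = (\<Sum>a\<in>{..<n}-{i}. f i a)"
    by (intro sum.cong refl assms(2))
  also have "\<dots> = (\<Sum>a<n. f i a)"
    using assms(1,3) by (subst (2) sum.remove[of _ i]) auto
  finally show ?thesis by simp
qed

text \<open>The scale \<open>s\<close> is to be read as \<open>1/h\<^sup>2\<close>: the random
  factor \<alpha> multiplies \<open>s\<close>, and the energy is convex in \<open>s\<close>.\<close>

definition energy :: "(real \<Rightarrow> real) \<Rightarrow> nat \<Rightarrow> real \<Rightarrow> (nat \<Rightarrow> 'a::euclidean_space) \<Rightarrow> real" where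
  "energy k n s X = (\<Sum>a<n. \<Sum>b<n. k (s * (dist (X a) (X b))\<^sup>2))"

lemma energy_nonneg: "profile k k' \<Longrightarrow> 0 \<le> s \<Longrightarrow> 0 \<le> energy k n s X"
  unfolding energy_def by (auto intro!: sum_nonneg profile_le_at_0(1)[of k k'])

lemma energy_le:
  assumes "profile k k'" "0 \<le> s"
  shows "energy k n s X \<le> (real n)\<^sup>2 * k 0"
proof -
  have "energy k n s X \<le> (\<Sum>a<n. \<Sum>b<n. k 0)"
    unfolding energy_def using assms by (intro sum_mono profile_le_at_0(2)[of k k']) auto
  then show ?thesis by (simp add: power2_eq_square)
qed

text \<open>The tangent inequality for \<open>k\<close> bounds the change of each pair from below by
  its weight times the drop of its squared distance. The balance identity evaluates the sum of these
  drops in terms of the squared displacement.\<close>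

lemma energy_mean_shift_ge:
  fixes X :: "nat \<Rightarrow> 'a::euclidean_space" and h :: real
  assumes prof: "profile k k'" and i: "i < n"
  defines "y \<equiv> mean_shift k' n h (X i) X"
  shows "energy k n (1/h\<^sup>2) X + 2 * (1/h\<^sup>2) * (- k' 0) * (dist y (X i))\<^sup>2
    \<le> energy k n (1/h\<^sup>2) (X(i := y))"
proof -
  define s where "s = 1/h\<^sup>2"
  have s: "0 \<le> s" by (simp add: s_def)
  define X' where "X' = X(i := y)"
  define w where "w a b = weightG k' ((1/h) *\<^sub>R (X a - X b))" for a b
  have w_eq: "w a b = - k' (s * (dist (X a) (X b))\<^sup>2)" for a b
    by (simp add: w_def weightG_scaled_diff s_def)
  have w: "0 \<le> w a b" for a b unfolding w_def by (rule weightG_nonneg[OF prof])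
  define f where "f a b = s * w a b * ((dist (X a) (X b))\<^sup>2 - (dist (X' a) (X' b))\<^sup>2)" for a b
  have "f a b \<le> k (s * (dist (X' a) (X' b))\<^sup>2) - k (s * (dist (X a) (X b))\<^sup>2)" for a b
    using profile_above_tangent[OF prof, of "s * (dist (X' a) (X' b))\<^sup>2" "s * (dist (X a) (X b))\<^sup>2"] s
    by (simp add: f_def w_eq algebra_simps)
  then have "(\<Sum>a<n. \<Sum>b<n. f a b) \<le> energy k n s X' - energy k n s X"
    unfolding energy_def sum_subtractf[symmetric] by (intro sum_mono)
  moreover have "(\<Sum>a<n. \<Sum>b<n. f a b) = 2 * (\<Sum>b<n. f i b)"
    by (rule sum_sum_supported_cross[OF i]) (auto simp: f_def w_eq X'_def dist_commute)
  moreover have "(\<Sum>b<n. f i b) \<ge> s * (- k' 0) * (dist y (X i))\<^sup>2"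
  proof -
    let ?W = "\<Sum>b<n. w i b"
    have bal: "?W *\<^sub>R (y - X i) = (\<Sum>b<n. w i b *\<^sub>R (X b - X i))"
      unfolding w_def y_def by (rule mean_shift_balance[OF prof i])
    \<comment> \<open>The bracket is the drop of the squared distance to an unmoved point. For
      \<open>b = i\<close> the distance is 0 before and after the step, so the last summand restores
      what the bracket subtracts.\<close>
    have f_eq: "f i b = s * w i b * (2 * inner (X b - X i) (y - X i) - (norm (y - X i))\<^sup>2)
        + (if b = i then s * w i i * (dist y (X i))\<^sup>2 else 0)" for b
    proof -
      have "(dist (X i) (X b))\<^sup>2 - (dist y (X b))\<^sup>2 = 2 * inner (X b - X i) (y - X i) - (norm (y - X i))\<^sup>2"
        unfolding dist_norm power2_norm_eq_inner
        by (simp add: inner_simps inner_commute algebra_simps)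
      from arg_cong[OF this, of "\<lambda>t. s * w i b * t"] show ?thesis
        unfolding f_def X'_def by (auto simp: dist_norm right_diff_distrib)
    qed
    have "(\<Sum>b<n. f i b) = s * (2 * (\<Sum>b<n. w i b * inner (X b - X i) (y - X i)) - ?W * (norm (y - X i))\<^sup>2)
        + s * w i i * (dist y (X i))\<^sup>2"
      unfolding f_eq using i
      by (simp add: sum.distrib sum_distrib_left sum_distrib_right sum_subtractf algebra_simps)
    also have "(\<Sum>b<n. w i b * inner (X b - X i) (y - X i)) = inner (\<Sum>b<n. w i b *\<^sub>R (X b - X i)) (y - X i)"
      by (simp add: inner_sum_left)
    also have "\<dots> = ?W * (norm (y - X i))\<^sup>2"
      unfolding bal[symmetric] by (simp add: power2_norm_eq_inner)
    finally have "(\<Sum>b<n. f i b) = s * (?W * (norm (y - X i))\<^sup>2) + s * w i i * (dist y (X i))\<^sup>2"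
      by simp
    \<comment> \<open>This part is simply dropped: the self-weight term alone gives a coefficient
      that does not depend on the state.\<close>
    moreover have "0 \<le> s * (?W * (norm (y - X i))\<^sup>2)"
      using s w by (intro mult_nonneg_nonneg sum_nonneg) auto
    moreover have "w i i = - k' 0" by (simp add: w_eq)
    ultimately show ?thesis by simp
  qed
  ultimately show ?thesis
    by (simp add: s_def X'_def)
qed

text \<open>For each pair \<open>k (s * d\<^sup>2)\<close> lies above its tangent in
  \<open>s\<close>. The correction is linear in \<open>s' - s\<close>, so it will have mean 0 for a
  centred increment.\<close>

lemma energy_above_tangent:
  assumes "profile k k'" "0 \<le> s" "0 \<le> s'"
  shows "energy k n s X
      + (s' - s) * (\<Sum>a<n. \<Sum>b<n. k' (s * (dist (X a) (X b))\<^sup>2) * (dist (X a) (X b))\<^sup>2)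
    \<le> energy k n s' X"
proof -
  have "k (s * d\<^sup>2) + (s' - s) * (k' (s * d\<^sup>2) * d\<^sup>2) \<le> k (s' * d\<^sup>2)" for d
    using profile_above_tangent[OF assms(1), of "s' * d\<^sup>2" "s * d\<^sup>2"] assms(2,3)
    by (simp add: algebra_simps)
  then show ?thesis
    unfolding energy_def sum_distrib_left sum.distrib[symmetric] by (intro sum_mono)
qed

section \<open>Small displacements force clustering\<close>

text \<open>Summation by parts; the weights are symmetric because they depend only on distances.\<close>

lemma dirichlet_form_le_displacement:
  fixes X :: "nat \<Rightarrow> 'a::euclidean_space"
  assumes prof: "profile k k'" and B: "\<And>j. j < n \<Longrightarrow> norm (X j) \<le> B"
  shows "(\<Sum>a<n. \<Sum>b<n. weightG k' ((1/h) *\<^sub>R (X a - X b)) * (dist (X a) (X b))\<^sup>2)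
    \<le> 2 * (n * (- k' 0) * B * (\<Sum>a<n. dist (mean_shift k' n h (X a) X) (X a)))"
proof -
  define w where "w a b = weightG k' ((1/h) *\<^sub>R (X a - X b))" for a b
  define y where "y a = mean_shift k' n h (X a) X" for a
  have w_sym: "w a b = w b a" for a b
    by (simp add: w_def weightG_scaled_diff dist_commute)
  have w: "0 \<le> w a b" for a b unfolding w_def by (rule weightG_nonneg[OF prof])
  have w_le: "w a b \<le> - k' 0" for a b unfolding w_def by (rule weightG_le[OF prof])
  \<comment> \<open>The weighted differences are tested against the points themselves; exchanging
    the two indices and adding the two expressions produces squared distances.\<close>
  define S where "S = (\<Sum>a<n. \<Sum>b<n. w a b * inner (X a) (X a - X b))"
  have "S = (\<Sum>a<n. \<Sum>b<n. w a b * inner (X b) (X b - X a))"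
    unfolding S_def by (subst sum.swap) (simp add: w_sym)
  then have "2 * S = (\<Sum>a<n. \<Sum>b<n. w a b * inner (X a) (X a - X b))
      + (\<Sum>a<n. \<Sum>b<n. w a b * inner (X b) (X b - X a))"
    by (simp add: S_def)
  also have "\<dots> = (\<Sum>a<n. \<Sum>b<n. w a b * (dist (X a) (X b))\<^sup>2)"
    unfolding sum.distrib[symmetric] dist_norm power2_norm_eq_inner
    by (intro sum.cong refl) (simp add: inner_simps inner_commute algebra_simps)
  finally have eq: "(\<Sum>a<n. \<Sum>b<n. w a b * (dist (X a) (X b))\<^sup>2) = 2 * S" ..
  have "S \<le> (\<Sum>a<n. n * (- k' 0) * B * dist (y a) (X a))"
    unfolding S_def
  proof (rule sum_mono)
    fix a assume "a \<in> {..<n}"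
    then have a: "a < n" by simp
    let ?W = "\<Sum>b<n. w a b"
    have W: "0 \<le> ?W" "?W \<le> n * (- k' 0)"
      using w w_le sum_bounded_above[of "{..<n}" "w a" "- k' 0"] by (auto intro: sum_nonneg)
    have "(\<Sum>b<n. w a b * inner (X a) (X a - X b)) = - inner (X a) (\<Sum>b<n. w a b *\<^sub>R (X b - X a))"
      by (simp add: inner_sum_right sum_negf[symmetric] inner_simps algebra_simps)
    \<comment> \<open>The balance identity replaces the weighted differences at \<open>a\<close> by
      the displacement of \<open>a\<close>.\<close>
    also have "\<dots> = - (?W * inner (X a) (y a - X a))"
      using mean_shift_balance[OF prof a, of h X] by (simp add: w_def y_def flip: inner_scaleR_right)
    also have "\<dots> \<le> ?W * (norm (X a) * norm (y a - X a))"
    proof -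
      have "- inner (X a) (y a - X a) \<le> norm (X a) * norm (y a - X a)"
        using Cauchy_Schwarz_ineq2[of "X a" "y a - X a"] by linarith
      from mult_left_mono[OF this W(1)] show ?thesis by simp
    qed
    also have "\<dots> \<le> (n * (- k' 0)) * (B * norm (y a - X a))"
      using W B[OF a] by (intro mult_mono mult_right_mono) auto
    finally show "(\<Sum>b<n. w a b * inner (X a) (X a - X b)) \<le> n * (- k' 0) * B * dist (y a) (X a)"
      by (simp add: dist_norm mult.assoc)
  qed
  also have "\<dots> = n * (- k' 0) * B * (\<Sum>a<n. dist (y a) (X a))"
    by (rule sum_distrib_left[symmetric])
  finally have "2 * S \<le> 2 * (n * (- k' 0) * B * (\<Sum>a<n. dist (y a) (X a)))"
    by linarith
  then show ?thesis
    unfolding eq[symmetric] unfolding w_def y_def .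
qed

text \<open>A pair at a distance between \<epsilon> and \<open>hmin - \<epsilon>\<close> has weight
  at least a fixed \<open>g > 0\<close> and alone contributes \<open>g * \<epsilon>\<^sup>2\<close>
  to the Dirichlet form, which tends to 0 with the displacements.\<close>

lemma eventually_near_or_far:
  fixes X :: "nat \<Rightarrow> nat \<Rightarrow> 'a::euclidean_space"
  assumes prof: "profile k k'" and hmin: "0 < hmin" "\<And>j. hmin \<le> h j"
    and B: "\<And>j a. a < n \<Longrightarrow> norm (X j a) \<le> B"
    and res: "\<And>a. a < n \<Longrightarrow> (\<lambda>j. dist (mean_shift k' n (h j) (X j a) (X j)) (X j a)) \<longlonglongrightarrow> 0"
    and eps: "0 < \<epsilon>" "\<epsilon> < hmin"
  shows "\<forall>\<^sub>F j in sequentially. \<forall>a<n. \<forall>b<n. dist (X j a) (X j b) < \<epsilon> \<or> hmin - \<epsilon> < dist (X j a) (X j b)"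
proof -
  \<comment> \<open>A lower bound for the weights in the intermediate range: as
    \<open>hmin \<le> h j\<close>, a distance up to \<open>hmin - \<epsilon>\<close> rescales to at
    most \<open>1 - \<epsilon> / hmin\<close>.\<close>
  define g where "g = - k' ((1 - \<epsilon> / hmin)\<^sup>2)"
  have "(1 - \<epsilon> / hmin)\<^sup>2 < 1"
    using eps hmin(1) by (intro power_less_one_iff[THEN iffD2]) (auto simp: field_simps)
  then have g: "0 < g" using prof by (simp add: g_def profile_def)
  define R where "R j = 2 * (n * (- k' 0) * B * (\<Sum>a<n. dist (mean_shift k' n (h j) (X j a) (X j)) (X j a)))" for j
  have "R \<longlonglongrightarrow> 2 * (n * (- k' 0) * B * (\<Sum>a<n. 0))"
    unfolding R_def by (intro tendsto_intros res) auto
  then have "R \<longlonglongrightarrow> 0" by simp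
  then have "\<forall>\<^sub>F j in sequentially. R j < g * \<epsilon>\<^sup>2"
    using g eps by (intro order_tendstoD(2)) auto
  then show ?thesis
  proof (rule eventually_mono)
    fix j assume R: "R j < g * \<epsilon>\<^sup>2"
    have False if ab: "a < n" "b < n"
      and "\<not> (dist (X j a) (X j b) < \<epsilon> \<or> hmin - \<epsilon> < dist (X j a) (X j b))" for a b
    proof -
      have d: "\<epsilon> \<le> dist (X j a) (X j b)" "dist (X j a) (X j b) \<le> hmin - \<epsilon>"
        using that(3) by auto
      let ?w = "\<lambda>a b. weightG k' ((1/h j) *\<^sub>R (X j a - X j b))"
      have hj: "0 < h j" using hmin(1) hmin(2)[of j] by linarith
      have "dist (X j a) (X j b) / h j \<le> (hmin - \<epsilon>) / hmin"
        using d eps hmin(1) hmin(2)[of j] by (intro frac_le) auto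
      then have "(dist (X j a) (X j b) / h j)\<^sup>2 \<le> (1 - \<epsilon> / hmin)\<^sup>2"
        using hmin(1) hj by (intro power_mono) (auto simp: field_simps)
      then have "g \<le> ?w a b"
        using profile_deriv_mono[OF prof, of "(1/(h j)\<^sup>2) * (dist (X j a) (X j b))\<^sup>2" "(1 - \<epsilon> / hmin)\<^sup>2"]
        by (simp add: weightG_scaled_diff g_def power_divide)
      then have "g * \<epsilon>\<^sup>2 \<le> ?w a b * (dist (X j a) (X j b))\<^sup>2"
        using d(1) eps g by (intro mult_mono power_mono) auto
      also have "\<dots> \<le> (\<Sum>b<n. ?w a b * (dist (X j a) (X j b))\<^sup>2)"
        using ab
        by (intro member_le_sum[where f = "\<lambda>b. ?w a b * (dist (X j a) (X j b))\<^sup>2"])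
           (auto intro!: mult_nonneg_nonneg weightG_nonneg[OF prof])
      also have "\<dots> \<le> (\<Sum>a<n. \<Sum>b<n. ?w a b * (dist (X j a) (X j b))\<^sup>2)"
        using ab
        by (intro member_le_sum[where f = "\<lambda>a. \<Sum>b<n. ?w a b * (dist (X j a) (X j b))\<^sup>2"])
           (auto intro!: sum_nonneg mult_nonneg_nonneg weightG_nonneg[OF prof])
      also have "\<dots> \<le> R j"
        unfolding R_def by (rule dirichlet_form_le_displacement[OF prof]) (rule B)
      finally show False using R by simp
    qed
    then show "\<forall>a<n. \<forall>b<n. dist (X j a) (X j b) < \<epsilon> \<or> hmin - \<epsilon> < dist (X j a) (X j b)"
      by blast
  qed
qed

text \<open>The near and far ranges are separated by a gap that one step cannot jump, so the near
  relation is eventually constant in time. The gap also makes it transitive, and its classes are the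
  clusters.\<close>

lemma clusters_stabilize:
  fixes X :: "nat \<Rightarrow> nat \<Rightarrow> 'a::metric_space"
  assumes "0 < hmin" "0 < \<tau>"
    and nf: "\<And>\<epsilon>. 0 < \<epsilon> \<Longrightarrow> \<epsilon> < hmin \<Longrightarrow> \<forall>\<^sub>F j in sequentially. \<forall>a<n. \<forall>b<n.
        dist (X j a) (X j b) < \<epsilon> \<or> hmin - \<epsilon> < dist (X j a) (X j b)"
    and step: "\<And>a. a < n \<Longrightarrow> (\<lambda>j. dist (X (Suc j) a) (X j a)) \<longlonglongrightarrow> 0"
  shows "\<exists>Ps. partition_on {..<n} Ps \<and>
        (\<exists>K. \<forall>j\<ge>K. (\<forall>J\<in>Ps. \<forall>a\<in>J. \<forall>b\<in>J. dist (X j a) (X j b) < \<tau>) \<and>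
           (\<forall>J\<in>Ps. \<forall>J'\<in>Ps. J \<noteq> J' \<longrightarrow> (\<forall>a\<in>J. \<forall>b\<in>J'. dist (X j a) (X j b) > hmin - \<tau>))) \<and>
        (\<forall>J\<in>Ps. (\<lambda>j. diameter (X j ` J)) \<longlonglongrightarrow> 0)"
proof -
  \<comment> \<open>One step will change a distance by less than \<open>2 * \<epsilon>\<close>. With
    \<open>4 * \<epsilon> \<le> hmin\<close>, a distance below \<epsilon> stays below
    \<open>hmin - \<epsilon>\<close>, and one above \<open>hmin - \<epsilon>\<close> stays above
    \<epsilon>.\<close>
  define \<epsilon> where "\<epsilon> = min \<tau> (hmin / 4)"
  have eps: "0 < \<epsilon>" "\<epsilon> < hmin" "\<epsilon> \<le> \<tau>" "4 * \<epsilon> \<le> hmin"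
    using assms(1,2) by (auto simp: \<epsilon>_def)
  have "\<forall>\<^sub>F j in sequentially. \<forall>a\<in>{..<n}. dist (X (Suc j) a) (X j a) < \<epsilon>"
    using order_tendstoD(2)[OF step eps(1)] by (intro eventually_ball_finite) auto
  then have "\<forall>\<^sub>F j in sequentially. (\<forall>a<n. \<forall>b<n.
        dist (X j a) (X j b) < \<epsilon> \<or> hmin - \<epsilon> < dist (X j a) (X j b)) \<and>
        (\<forall>a<n. dist (X (Suc j) a) (X j a) < \<epsilon>)"
    using nf[OF eps(1,2)] by eventually_elim auto
  then obtain K where K: "\<And>j a b. K \<le> j \<Longrightarrow> a < n \<Longrightarrow> b < n \<Longrightarrow>
        dist (X j a) (X j b) < \<epsilon> \<or> hmin - \<epsilon> < dist (X j a) (X j b)"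
    "\<And>j a. K \<le> j \<Longrightarrow> a < n \<Longrightarrow> dist (X (Suc j) a) (X j a) < \<epsilon>"
    unfolding eventually_sequentially by blast
  have stable: "dist (X j a) (X j b) < \<epsilon> \<longleftrightarrow> dist (X K a) (X K b) < \<epsilon>"
    if "K \<le> j" "a < n" "b < n" for j a b
    using that(1)
  proof (induction j rule: dec_induct)
    case (step j)
    have "\<bar>dist (X (Suc j) a) (X (Suc j) b) - dist (X j a) (X j b)\<bar> < 2 * \<epsilon>"
      using K(2)[OF step(1) that(2)] K(2)[OF step(1) that(3)]
        dist_triangle[of "X (Suc j) a" "X (Suc j) b" "X j a"]
        dist_triangle[of "X j a" "X (Suc j) b" "X j b"]
        dist_triangle[of "X j a" "X j b" "X (Suc j) a"]
        dist_triangle[of "X (Suc j) a" "X j b" "X (Suc j) b"]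
      by (simp add: dist_commute abs_if)
    then show ?case
      using K(1)[OF step(1) that(2,3)] K(1)[of "Suc j" a b] step that(2,3) eps(4) by force
  qed simp
  define E where "E = {(a, b). a < n \<and> b < n \<and> dist (X K a) (X K b) < \<epsilon>}"
  have E: "equiv {..<n} E"
  proof (rule equivI)
    show "trans E"
    proof (rule transI)
      fix a b c assume "(a, b) \<in> E" "(b, c) \<in> E"
      \<comment> \<open>The outer points are at a distance below
        \<open>2 * \<epsilon> \<le> hmin - \<epsilon>\<close>, so the far alternative fails.\<close>
      then show "(a, c) \<in> E"
        using dist_triangle[of "X K a" "X K c" "X K b"] K(1)[of K a c] eps(4)
        by (auto simp: E_def)
    qed
  qed (auto simp: E_def refl_on_def sym_def dist_commute eps)
  define Ps where "Ps = {..<n} // E"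
  have part: "partition_on {..<n} Ps"
    unfolding Ps_def by (rule partition_on_quotient[OF E])
  have sub: "J \<subseteq> {..<n}" if "J \<in> Ps" for J
    using part that by (auto simp: partition_on_def)
  have same: "(a, b) \<in> E" if "J \<in> Ps" "a \<in> J" "b \<in> J" for J a b
    using quotient_eq_iff[OF E, of J J a b] that by (auto simp: Ps_def)
  have diff: "(a, b) \<notin> E" if "J \<in> Ps" "J' \<in> Ps" "J \<noteq> J'" "a \<in> J" "b \<in> J'" for J J' a b
    using quotient_eq_iff[OF E, of J J' a b] that by (auto simp: Ps_def)
  have near: "dist (X j a) (X j b) < \<epsilon>" if "K \<le> j" "J \<in> Ps" "a \<in> J" "b \<in> J" for j J a b
    using stable[OF that(1)] same[OF that(2-4)] by (auto simp: E_def)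
  have far: "hmin - \<epsilon> < dist (X j a) (X j b)"
    if "K \<le> j" "J \<in> Ps" "J' \<in> Ps" "J \<noteq> J'" "a \<in> J" "b \<in> J'" for j J J' a b
    using stable[OF that(1), of a b] diff[OF that(2-6)] sub[OF that(2)] sub[OF that(3)] that
      K(1)[OF that(1), of a b]
    by (auto simp: E_def subset_iff)
  have diam: "(\<lambda>j. diameter (X j ` J)) \<longlonglongrightarrow> 0" if J: "J \<in> Ps" for J
  proof (rule tendstoI)
    fix e :: real assume e: "0 < e"
    \<comment> \<open>The bound by \<epsilon> ensures that points of one cluster, already closer
      than \<epsilon>, are not far in the sense of \<open>e'\<close>; halving \<open>e\<close>
      yields a strict bound on the diameter.\<close>
    define e' where "e' = min (e / 2) \<epsilon>"
    have e': "0 < e'" "e' < hmin" "e' \<le> \<epsilon>" "e' < e" using e eps by (auto simp: e'_def)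
    have fin: "finite J" using sub[OF J] finite_subset by blast
    have "\<forall>\<^sub>F j in sequentially. K \<le> j" by (rule eventually_ge_at_top)
    with nf[OF e'(1,2)] show "\<forall>\<^sub>F j in sequentially. dist (diameter (X j ` J)) 0 < e"
    proof eventually_elim
      case (elim j)
      have "dist (X j a) (X j b) \<le> e'" if "a \<in> J" "b \<in> J" for a b
      proof -
        have "a < n" "b < n" using sub[OF J] that by auto
        then have "dist (X j a) (X j b) < e' \<or> hmin - e' < dist (X j a) (X j b)"
          using elim(1) by blast
        then show ?thesis using near[OF elim(2) J that] e'(3) eps(1,4) by linarith
      qed
      then have "diameter (X j ` J) \<le> e'"
        using e'(1) by (auto simp: diameter_def intro!: cSUP_least)
      moreover have "0 \<le> diameter (X j ` J)"
        using fin by (intro diameter_ge_0 finite_imp_bounded) auto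
      ultimately show ?case using e'(4) by simp
    qed
  qed
  show ?thesis
  proof (intro exI[of _ Ps] conjI exI[of _ K] allI impI ballI part diam)
    fix j J a b assume "K \<le> j" "J \<in> Ps" "a \<in> J" "b \<in> J"
    then show "dist (X j a) (X j b) < \<tau>"
      using near eps(3) by fastforce
  next
    fix j J J' a b assume "K \<le> j" "J \<in> Ps" "J' \<in> Ps" "J \<noteq> J'" "a \<in> J" "b \<in> J'"
    then show "hmin - \<tau> < dist (X j a) (X j b)"
      using far[of j J J' a b] eps(3) by linarith
  qed
qed

section \<open>Sample paths\<close>

text \<open>The width \<delta> inside \<open>dsms_h\<close>, isolated so that its bounds can be
  stated; \<open>r\<close> stands for the current value of \<nu>.\<close>

definition dsms_delta :: "real \<Rightarrow> real \<Rightarrow> real \<Rightarrow> real \<Rightarrow> real" where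
  "dsms_delta hmin hmax r h = min r (min ((h / hmin)\<^sup>2 - 1) (1 - (h / hmax)\<^sup>2))"

lemma dsms_h_Suc:
  "dsms_h hmin hmax \<nu> h1 u (Suc m) =
    (let h = dsms_h hmin hmax \<nu> h1 u m in h / sqrt (1 + dsms_delta hmin hmax (\<nu> (Suc m)) h * u (Suc m)))"
  by (simp add: dsms_delta_def Let_def)

lemma dsms_delta_bounds:
  assumes "0 < hmin" "hmin \<le> h" "h \<le> hmax" "0 \<le> r"
  shows "0 \<le> dsms_delta hmin hmax r h" "dsms_delta hmin hmax r h \<le> 1"
    "dsms_delta hmin hmax r h \<le> (h / hmin)\<^sup>2 - 1" "dsms_delta hmin hmax r h \<le> 1 - (h / hmax)\<^sup>2"
proof -
  have "1\<^sup>2 \<le> (h / hmin)\<^sup>2" using assms by (intro power_mono) auto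
  moreover have "(h / hmax)\<^sup>2 \<le> 1\<^sup>2" using assms by (intro power_mono) auto
  ultimately show "0 \<le> dsms_delta hmin hmax r h"
    using assms by (simp add: dsms_delta_def)
qed (auto simp: dsms_delta_def min_le_iff_disj)

text \<open>As \<open>\<bar>v\<bar> < 1\<close>, the factor \<alpha> deviates from 1 by at most
  \<delta>, and the two caps in \<delta> apply. These bounds are what keeps
  \<open>h / sqrt \<alpha>\<close> between \<open>hmin\<close> and \<open>hmax\<close>.\<close>

lemma dsms_alpha_bounds:
  assumes "0 < hmin" "hmin \<le> h" "h \<le> hmax" "0 \<le> r" "\<bar>v\<bar> < 1"
  shows "(h / hmax)\<^sup>2 \<le> 1 + dsms_delta hmin hmax r h * v"
    "1 + dsms_delta hmin hmax r h * v \<le> (h / hmin)\<^sup>2"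
proof -
  note d = dsms_delta_bounds[OF assms(1-4)]
  let ?d = "dsms_delta hmin hmax r h"
  have "\<bar>?d * v\<bar> \<le> ?d"
    using d(1) assms(5) by (simp add: abs_mult mult_left_le)
  then show "(h / hmax)\<^sup>2 \<le> 1 + ?d * v" "1 + ?d * v \<le> (h / hmin)\<^sup>2"
    using d(3,4) by linarith+
qed

lemma dsms_h_bounds:
  assumes "0 < hmin" "hmin \<le> h1" "h1 \<le> hmax" "\<And>j. 0 \<le> \<nu> j" "\<And>j. \<bar>u j\<bar> < 1"
  shows "hmin \<le> dsms_h hmin hmax \<nu> h1 u m" "dsms_h hmin hmax \<nu> h1 u m \<le> hmax"
proof -
  have "hmin \<le> dsms_h hmin hmax \<nu> h1 u m \<and> dsms_h hmin hmax \<nu> h1 u m \<le> hmax"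
  proof (induction m)
    case (Suc m)
    define h where "h = dsms_h hmin hmax \<nu> h1 u m"
    define \<alpha> where "\<alpha> = 1 + dsms_delta hmin hmax (\<nu> (Suc m)) h * u (Suc m)"
    have h: "hmin \<le> h" "h \<le> hmax" "0 < h" "0 < hmax" using Suc assms by (auto simp: h_def)
    have "h / hmax \<le> sqrt \<alpha>" "sqrt \<alpha> \<le> h / hmin"
      using dsms_alpha_bounds[OF assms(1) h(1,2) assms(4,5)] h assms(1)
      by (auto simp: \<alpha>_def intro!: real_le_rsqrt real_le_lsqrt)
    moreover from this(1) have "0 < sqrt \<alpha>"
      using divide_pos_pos[OF h(3,4)] by linarith
    ultimately have "hmin \<le> h / sqrt \<alpha> \<and> h / sqrt \<alpha> \<le> hmax"
      using h assms(1) by (simp add: field_simps)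
    moreover have "dsms_h hmin hmax \<nu> h1 u (Suc m) = h / sqrt \<alpha>"
      unfolding dsms_h_Suc by (simp add: Let_def h_def \<alpha>_def)
    ultimately show ?case by (simp only:)
  qed (use assms in auto)
  then show "hmin \<le> dsms_h hmin hmax \<nu> h1 u m" "dsms_h hmin hmax \<nu> h1 u m \<le> hmax" by auto
qed

text \<open>In the scale \<open>1/h\<^sup>2\<close> the bandwidth update is multiplication by
  \<alpha>, so the increment is linear in \<open>u (Suc m)\<close>. The lower bound on \<alpha>
  makes it legitimate to square the root.\<close>

lemma inverse_square_dsms_h_Suc:
  assumes "0 < hmin" "hmin \<le> h1" "h1 \<le> hmax" "\<And>j. 0 \<le> \<nu> j" "\<And>j. \<bar>u j\<bar> < 1"
  defines "h \<equiv> dsms_h hmin hmax \<nu> h1 u"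
  shows "1 / (h (Suc m))\<^sup>2 = (1 / (h m)\<^sup>2) * (1 + dsms_delta hmin hmax (\<nu> (Suc m)) (h m) * u (Suc m))"
proof -
  have h: "hmin \<le> h m" "h m \<le> hmax"
    unfolding h_def using dsms_h_bounds[OF assms(1-5)] by auto
  have "0 \<le> (h m / hmax)\<^sup>2" by simp
  then have "0 \<le> 1 + dsms_delta hmin hmax (\<nu> (Suc m)) (h m) * u (Suc m)"
    using dsms_alpha_bounds(1)[OF assms(1) h assms(4,5)] by (rule order_trans)
  then show ?thesis
    unfolding h_def dsms_h_Suc Let_def by (simp add: power_divide)
qed

lemma dsms_h_cong:
  assumes "\<And>j. j \<le> m \<Longrightarrow> u j = u' j"
  shows "dsms_h hmin hmax \<nu> h1 u m = dsms_h hmin hmax \<nu> h1 u' m"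
  using assms by (induction m) (auto simp: Let_def)

text \<open>State \<open>m\<close> is built with bandwidths of index below \<open>m\<close>, whereas
  bandwidth \<open>m\<close> already reads \<open>u m\<close>. Hence state \<open>m\<close> is
  determined by the draws before \<open>m\<close>, and bandwidth \<open>m\<close> by these together
  with \<open>u m\<close>.\<close>

lemma dsms_x_cong:
  assumes "\<And>j. j < m \<Longrightarrow> i j = i' j" "\<And>j. j < m \<Longrightarrow> u j = u' j"
  shows "dsms_x k' n hmin hmax \<nu> h1 X0 i u m = dsms_x k' n hmin hmax \<nu> h1 X0 i' u' m"
  using assms
proof (induction m)
  case (Suc m)
  then have "dsms_h hmin hmax \<nu> h1 u m = dsms_h hmin hmax \<nu> h1 u' m"
    by (intro dsms_h_cong) auto
  with Suc show ?case by (simp add: Let_def)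
qed simp

lemma norm_dsms_x_le:
  assumes "profile k k'" "\<And>a. a < n \<Longrightarrow> norm (X0 a) \<le> B" "a < n"
  shows "norm (dsms_x k' n hmin hmax \<nu> h1 X0 i u m a) \<le> B"
  using assms(3)
proof (induction m arbitrary: a)
  case (Suc m)
  then show ?case
    using norm_mean_shift_le[OF assms(1), of a n] by (auto simp: Let_def)
qed (use assms(2) in auto)

section \<open>Measurability\<close>

text \<open>Continuity is given only on the half-line; composing with \<open>max 0\<close> extends
  \<open>g\<close> continuously to all reals without changing it on the values of
  \<open>f\<close>.\<close>

lemma borel_measurable_continuous_nonneg:
  fixes g :: "real \<Rightarrow> real"
  assumes "continuous_on {0..} g" "f \<in> borel_measurable N" "\<And>x. 0 \<le> f x"
  shows "(\<lambda>x. g (f x)) \<in> borel_measurable N"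
proof -
  have "continuous_on UNIV (\<lambda>t. g (max 0 t))"
    by (rule continuous_on_compose2[OF assms(1)]) (auto intro!: continuous_intros)
  then have "(\<lambda>x. g (max 0 (f x))) \<in> borel_measurable N"
    by (rule borel_measurable_continuous_on) (rule assms(2))
  with assms(3) show ?thesis by (simp add: max_absorb2)
qed

lemma profile_continuous_on:
  assumes "profile k k'"
  shows "continuous_on {0..} k" "continuous_on {0..} k'"
  using assms by (auto simp: profile_def intro: DERIV_continuous_on[where D = k'])

lemma borel_measurable_mean_shift:
  fixes X :: "'w \<Rightarrow> nat \<Rightarrow> 'a::euclidean_space"
  assumes prof: "profile k k'" and [measurable]: "h \<in> borel_measurable N" "x \<in> borel_measurable N"
    and [measurable]: "\<And>a. (\<lambda>\<omega>. X \<omega> a) \<in> borel_measurable N"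
  shows "(\<lambda>\<omega>. mean_shift k' n (h \<omega>) (x \<omega>) (X \<omega>)) \<in> borel_measurable N"
proof -
  have [measurable]: "(\<lambda>\<omega>. weightG k' ((1 / h \<omega>) *\<^sub>R (x \<omega> - X \<omega> a))) \<in> borel_measurable N" for a
    unfolding weightG_def
    by (intro borel_measurable_uminus borel_measurable_continuous_nonneg[OF profile_continuous_on(2)[OF prof]])
       auto
  show ?thesis
    unfolding mean_shift_def by measurable
qed

lemma borel_measurable_energy:
  fixes X :: "'w \<Rightarrow> nat \<Rightarrow> 'a::euclidean_space"
  assumes prof: "profile k k'" and [measurable]: "s \<in> borel_measurable N" "\<And>a. (\<lambda>\<omega>. X \<omega> a) \<in> borel_measurable N"
    and "\<And>\<omega>. 0 \<le> s \<omega>"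
  shows "(\<lambda>\<omega>. energy k n (s \<omega>) (X \<omega>)) \<in> borel_measurable N"
  unfolding energy_def using assms(4)
  by (intro borel_measurable_sum borel_measurable_continuous_nonneg[OF profile_continuous_on(1)[OF prof]]) auto

lemma borel_measurable_dsms_h:
  assumes "\<And>j. j \<le> m \<Longrightarrow> u j \<in> borel_measurable N"
  shows "(\<lambda>\<omega>. dsms_h hmin hmax \<nu> h1 (\<lambda>j. u j \<omega>) m) \<in> borel_measurable N"
  using assms
proof (induction m)
  case (Suc m)
  have [measurable]: "(\<lambda>\<omega>. dsms_h hmin hmax \<nu> h1 (\<lambda>j. u j \<omega>) m) \<in> borel_measurable N"
    "u (Suc m) \<in> borel_measurable N"
    using Suc by auto
  show ?case by (simp add: Let_def)
qed simp

lemma borel_measurable_dsms_x: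
  fixes X0 :: "nat \<Rightarrow> 'a::euclidean_space"
  assumes prof: "profile k k'"
    and "\<And>j. j < m \<Longrightarrow> i j \<in> measurable N (count_space UNIV)" "\<And>j. j < m \<Longrightarrow> u j \<in> borel_measurable N"
  shows "(\<lambda>\<omega>. dsms_x k' n hmin hmax \<nu> h1 X0 (\<lambda>j. i j \<omega>) (\<lambda>j. u j \<omega>) m a) \<in> borel_measurable N"
  using assms(2,3)
proof (induction m arbitrary: a)
  case (Suc m)
  define X where "X \<omega> = dsms_x k' n hmin hmax \<nu> h1 X0 (\<lambda>j. i j \<omega>) (\<lambda>j. u j \<omega>) m" for \<omega>
  define h where "h \<omega> = dsms_h hmin hmax \<nu> h1 (\<lambda>j. u j \<omega>) m" for \<omega>
  have X[measurable]: "(\<lambda>\<omega>. X \<omega> a) \<in> borel_measurable N" for a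
    unfolding X_def using Suc by auto
  have h[measurable]: "h \<in> borel_measurable N"
    unfolding h_def by (rule borel_measurable_dsms_h) (use Suc.prems in auto)
  have [measurable]: "i m \<in> measurable N (count_space UNIV)" using Suc.prems by auto
  have [measurable]: "(\<lambda>\<omega>. mean_shift k' n (h \<omega>) (X \<omega> a) (X \<omega>)) \<in> borel_measurable N" for a
    by (rule borel_measurable_mean_shift[OF prof h X X])
  \<comment> \<open>An update at a random index is, for a fixed coordinate \<open>a\<close>, a case
    distinction on the measurable event that \<open>a\<close> is drawn.\<close>
  have "(\<lambda>\<omega>. if i m \<omega> = a then mean_shift k' n (h \<omega>) (X \<omega> a) (X \<omega>) else X \<omega> a) \<in> borel_measurable N"
    by measurable
  also have "(\<lambda>\<omega>. if i m \<omega> = a then mean_shift k' n (h \<omega>) (X \<omega> a) (X \<omega>) else X \<omega> a)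
    = (\<lambda>\<omega>. dsms_x k' n hmin hmax \<nu> h1 X0 (\<lambda>j. i j \<omega>) (\<lambda>j. u j \<omega>) (Suc m) a)"
    by (auto simp: Let_def X_def h_def fun_eq_iff)
  finally show ?case .
qed simp

section \<open>Expectations\<close>

text \<open>By monotone convergence the sum of the series has finite integral, so it is finite
  almost everywhere and its terms tend to 0.\<close>

lemma AE_tendsto_0_of_bounded_integrals:
  fixes f :: "nat \<Rightarrow> 'w \<Rightarrow> real"
  assumes int: "\<And>m. integrable M (f m)" and nn: "\<And>m \<omega>. 0 \<le> f m \<omega>"
    and bd: "\<And>K. (\<Sum>m<K. \<integral>\<omega>. f m \<omega> \<partial>M) \<le> C"
  shows "AE \<omega> in M. (\<lambda>m. f m \<omega>) \<longlonglongrightarrow> 0"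
proof -
  have [measurable]: "f m \<in> borel_measurable M" for m using int by auto
  have I: "0 \<le> (\<integral>\<omega>. f m \<omega> \<partial>M)" for m using nn by simp
  have "summable (\<lambda>m. \<integral>\<omega>. f m \<omega> \<partial>M)"
    using bd I by (intro summableI_nonneg_bounded[where x = C]) auto
  then have "(\<Sum>m. ennreal (\<integral>\<omega>. f m \<omega> \<partial>M)) \<noteq> \<infinity>"
    using I by (subst suminf_ennreal2) auto
  moreover have "(\<integral>\<^sup>+\<omega>. (\<Sum>m. ennreal (f m \<omega>)) \<partial>M) = (\<Sum>m. ennreal (\<integral>\<omega>. f m \<omega> \<partial>M))"
    using int nn by (subst nn_integral_suminf) (auto intro!: suminf_cong nn_integral_eq_integral)
  ultimately have "AE \<omega> in M. (\<Sum>m. ennreal (f m \<omega>)) \<noteq> \<infinity>"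
    by (intro nn_integral_PInf_AE) auto
  then show ?thesis
  proof eventually_elim
    case (elim \<omega>)
    then show ?case
      using nn by (intro summable_LIMSEQ_zero summable_suminf_not_top) auto
  qed
qed

lemma integral_uniform_symmetric: "(\<integral>x. x \<partial>uniform_measure lborel {-1<..<1::real}) = 0"
proof -
  let ?f = "\<lambda>x::real. (indicator {-1<..<1} x / 2) *\<^sub>R x"
  have "uniform_measure lborel {-1<..<1::real} = density lborel (\<lambda>x. ennreal (indicator {-1<..<1} x / 2))"
    unfolding uniform_measure_def
    by (rule arg_cong[where f = "density lborel"])
       (auto simp: fun_eq_iff indicator_def divide_ennreal[symmetric])
  then have eq: "(\<integral>x. x \<partial>uniform_measure lborel {-1<..<1::real}) = (\<integral>x. ?f x \<partial>lborel)"
    by (simp add: integral_density)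
  \<comment> \<open>The reflection \<open>x \<mapsto> -x\<close> turns the integral into its own
    negative.\<close>
  have "(\<integral>x. ?f x \<partial>lborel) = \<bar>-1\<bar> *\<^sub>R (\<integral>x. ?f (0 + -1 * x) \<partial>lborel)"
    by (rule lborel_integral_real_affine) simp
  moreover have "(\<lambda>x. ?f (0 + -1 * x)) = (\<lambda>x. - ?f x)"
    by (auto simp: fun_eq_iff indicator_def)
  moreover have "(\<integral>x. - ?f x \<partial>lborel) = - (\<integral>x. ?f x \<partial>lborel)"
    by (rule Bochner_Integration.integral_minus)
  ultimately have "(\<integral>x. ?f x \<partial>lborel) = - (\<integral>x. ?f x \<partial>lborel)"
    by (simp only: scaleR_one abs_minus abs_one abs_minus_cancel)
  then show ?thesis
    unfolding eq by linarith
qed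

lemma prob_space_uniform_Ioo: "prob_space (uniform_measure lborel {-1<..<1::real})"
  by (rule prob_space_uniform_measure) auto

section \<open>Probability model and its independence structure\<close>

locale dsms = prob_space M for M :: "'w measure" +
  fixes k k' :: "real \<Rightarrow> real" and n :: nat and hmin hmax h1 :: real and \<nu> :: "nat \<Rightarrow> real"
    and X0 :: "nat \<Rightarrow> 'a::euclidean_space" and I :: "nat \<Rightarrow> 'w \<Rightarrow> nat" and U :: "nat \<Rightarrow> 'w \<Rightarrow> real"
  assumes prof: "profile k k'"
    and n: "n \<ge> 1"
    and hpos: "0 < hmin" "hmin < hmax"
    and h1: "hmin \<le> h1" "h1 \<le> hmax"
    and nu_nonneg: "\<And>j. \<nu> j \<ge> 0"
    and indep: "indep_vars (\<lambda>_. count_space UNIV \<Otimes>\<^sub>M lborel) (\<lambda>j \<omega>. (I j \<omega>, U j \<omega>)) UNIV"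
    and distr: "\<And>j. distr M (count_space UNIV \<Otimes>\<^sub>M lborel) (\<lambda>\<omega>. (I j \<omega>, U j \<omega>))
                   = measure_pmf (pmf_of_set {..<n}) \<Otimes>\<^sub>M uniform_measure lborel {-1<..<1}"
begin

abbreviation "S \<equiv> (count_space UNIV \<Otimes>\<^sub>M lborel :: (nat \<times> real) measure)"

abbreviation "past_space m \<equiv> Pi\<^sub>M {..<m} (\<lambda>_. S)"

text \<open>Everything drawn strictly before step \<open>m\<close>; the restriction makes it a point
  of the finite product space \<open>past_space m\<close>.\<close>

definition past :: "nat \<Rightarrow> 'w \<Rightarrow> nat \<Rightarrow> nat \<times> real" where
  "past m \<omega> = (\<lambda>j\<in>{..<m}. (I j \<omega>, U j \<omega>))"

lemma measurable_IU[measurable]: "(\<lambda>\<omega>. (I j \<omega>, U j \<omega>)) \<in> measurable M S"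
  using indep by (auto simp: indep_vars_def)

lemma measurable_I[measurable]: "I j \<in> measurable M (count_space UNIV)"
  using measurable_compose[OF measurable_IU measurable_fst] by simp

lemma measurable_U[measurable]: "U j \<in> borel_measurable M"
  using measurable_compose[OF measurable_IU measurable_snd] by simp

text \<open>Both components of \<^const>\<open>indep_var\<close> must have the same type, hence the singleton product.\<close>

lemma indep_past: "indep_var (past_space m) (past m) (Pi\<^sub>M {m} (\<lambda>_. S)) (\<lambda>\<omega>. \<lambda>j\<in>{m}. (I j \<omega>, U j \<omega>))"
  unfolding past_def[abs_def] by (rule indep_var_restrict[OF indep]) auto

lemma measurable_past[measurable]: "past m \<in> measurable M (past_space m)"
  using indep_past[of m] by (rule indep_var_rv1)

lemma distr_U: "distr M lborel (U j) = uniform_measure lborel {-1<..<1}"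
proof (rule measure_eqI)
  fix A assume "A \<in> sets (distr M lborel (U j))"
  then have A[measurable]: "A \<in> sets borel" by simp
  interpret B: prob_space "uniform_measure lborel {-1<..<1::real}"
    by (rule prob_space_uniform_Ioo)
  have "emeasure (distr M lborel (U j)) A = emeasure (distr M S (\<lambda>\<omega>. (I j \<omega>, U j \<omega>))) (UNIV \<times> A)"
    by (auto simp: emeasure_distr intro!: arg_cong[where f = "emeasure M"])
  also have "\<dots> = emeasure (uniform_measure lborel {-1<..<1}) A"
    unfolding distr by (subst B.emeasure_pair_measure_Times) (auto simp: measure_pmf.emeasure_space_1[simplified])
  finally show "emeasure (distr M lborel (U j)) A = emeasure (uniform_measure lborel {-1<..<1}) A" .
qed simp

lemma AE_U: "AE \<omega> in M. \<forall>j. \<bar>U j \<omega>\<bar> < 1"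
proof (subst AE_all_countable, rule allI)
  fix j
  have "AE x in uniform_measure lborel {-1<..<1::real}. \<bar>x\<bar> < 1"
    by (rule AE_uniform_measureI) auto
  then have "AE x in distr M lborel (U j). \<bar>x\<bar> < 1" unfolding distr_U .
  then show "AE \<omega> in M. \<bar>U j \<omega>\<bar> < 1"
    by (subst (asm) AE_distr_iff) auto
qed

lemma expectation_U: "expectation (U j) = 0"
proof -
  have "expectation (U j) = (\<integral>x. x \<partial>distr M lborel (U j))"
    by (subst integral_distr) auto
  then show ?thesis unfolding distr_U integral_uniform_symmetric .
qed

lemma integrable_U: "integrable M (U j)"
  using AE_U by (intro integrable_const_bound[where B = 1]) (auto elim!: eventually_mono intro: less_imp_le)

text \<open>The draw \<open>U m\<close> is independent of the past and has mean 0, so it is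
  orthogonal to every integrable factor determined by the past.\<close>

lemma expectation_past_mult_U:
  assumes [measurable]: "f \<in> borel_measurable (past_space m)" and "integrable M (\<lambda>\<omega>. f (past m \<omega>))"
  shows "integrable M (\<lambda>\<omega>. f (past m \<omega>) * U m \<omega>)" "expectation (\<lambda>\<omega>. f (past m \<omega>) * U m \<omega>) = 0"
proof -
  have "indep_var borel (f \<circ> past m) borel ((\<lambda>y. snd (y m)) \<circ> (\<lambda>\<omega>. \<lambda>j\<in>{m}. (I j \<omega>, U j \<omega>)))"
    by (rule indep_var_compose[OF indep_past]) auto
  then have ind: "indep_var borel (\<lambda>\<omega>. f (past m \<omega>)) borel (U m)"
    by (simp add: comp_def)
  show "integrable M (\<lambda>\<omega>. f (past m \<omega>) * U m \<omega>)"
    by (rule indep_var_integrable[OF ind assms(2) integrable_U])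
  show "expectation (\<lambda>\<omega>. f (past m \<omega>) * U m \<omega>) = 0"
    using indep_var_lebesgue_integral[OF ind assms(2) integrable_U] by (simp add: expectation_U)
qed

text \<open>The past is independent of the pair drawn at step \<open>m\<close>, and the law of that
  pair is a product. Tonelli then splits the index off from the past and \<open>U m\<close> jointly;
  \<open>U m\<close> has to be included because bandwidth \<open>m\<close> depends on it.\<close>

lemma nn_integral_index_mult:
  fixes c :: "nat \<Rightarrow> ennreal"
  assumes F[measurable]: "F \<in> borel_measurable (past_space m \<Otimes>\<^sub>M lborel)"
  shows "(\<integral>\<^sup>+\<omega>. c (I m \<omega>) * F (past m \<omega>, U m \<omega>) \<partial>M)
    = (\<integral>\<^sup>+i. c i \<partial>measure_pmf (pmf_of_set {..<n})) *
      (\<integral>\<^sup>+p. \<integral>\<^sup>+v. F (p, v) \<partial>uniform_measure lborel {-1<..<1} \<partial>distr M (past_space m) (past m))"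
proof -
  let ?A = "measure_pmf (pmf_of_set {..<n})" and ?B = "uniform_measure lborel {-1<..<1::real}"
  let ?Q = "distr M (past_space m) (past m)"
  interpret B: prob_space ?B by (rule prob_space_uniform_Ioo)
  have sB[measurable_cong]: "sets ?B = sets borel" by simp
  have sQ[measurable_cong]: "sets ?Q = sets (past_space m)" by simp
  have sA[measurable_cong]: "sets ?A = sets (count_space UNIV)" by simp
  have c[measurable]: "c \<in> borel_measurable ?A" by simp
  let ?Y = "\<lambda>\<omega>. \<lambda>j\<in>{m}. (I j \<omega>, U j \<omega>)" and ?S' = "Pi\<^sub>M {m} (\<lambda>_. S)"
  let ?R = "distr M ?S' ?Y"
  have Y[measurable]: "?Y \<in> measurable M ?S'" by (rule indep_var_rv2[OF indep_past])
  interpret R: prob_space ?R by (rule prob_space_distr) (rule Y)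
  have sR[measurable_cong]: "sets ?R = sets ?S'" by simp
  have D: "distr M (past_space m \<Otimes>\<^sub>M ?S') (\<lambda>\<omega>. (past m \<omega>, ?Y \<omega>)) = ?Q \<Otimes>\<^sub>M ?R"
    using indep_past[of m] unfolding indep_var_distribution_eq by simp
  let ?H = "\<lambda>x. c (fst (snd x)) * F (fst x, snd (snd x))"
  let ?G = "\<lambda>x. ?H (fst x, snd x m)"
  have H: "?H \<in> borel_measurable (past_space m \<Otimes>\<^sub>M S)" by measurable
  have G: "?G \<in> borel_measurable (past_space m \<Otimes>\<^sub>M ?S')"
    by (rule measurable_compose[OF _ H]) measurable
  have G': "?G \<in> borel_measurable (?Q \<Otimes>\<^sub>M ?R)"
    using G by (simp cong: measurable_cong_sets sets_pair_measure_cong)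
  have "(\<integral>\<^sup>+\<omega>. c (I m \<omega>) * F (past m \<omega>, U m \<omega>) \<partial>M) =
      (\<integral>\<^sup>+x. ?G x \<partial>distr M (past_space m \<Otimes>\<^sub>M ?S') (\<lambda>\<omega>. (past m \<omega>, ?Y \<omega>)))"
    by (subst nn_integral_distr) (use G in auto)
  also have "\<dots> = (\<integral>\<^sup>+p. \<integral>\<^sup>+y. ?G (p, y) \<partial>?R \<partial>?Q)"
    unfolding D by (rule R.nn_integral_fst[symmetric, OF G'])
  also have "\<dots> = (\<integral>\<^sup>+p. (\<integral>\<^sup>+i. c i \<partial>?A) * (\<integral>\<^sup>+v. F (p, v) \<partial>?B) \<partial>?Q)"
  proof (rule nn_integral_cong)
    fix p assume "p \<in> space ?Q"
    then have p[measurable]: "p \<in> space (past_space m)" by simp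
    have Fp[measurable]: "(\<lambda>v. F (p, v)) \<in> borel_measurable ?B"
      by (rule measurable_compose[OF _ F]) measurable
    have Hp: "(\<lambda>y. ?H (p, y)) \<in> borel_measurable S"
      by (rule measurable_compose[OF _ H]) measurable
    have Hp': "(\<lambda>y. ?H (p, y)) \<in> borel_measurable (?A \<Otimes>\<^sub>M ?B)"
      using Hp by (simp cong: measurable_cong_sets sets_pair_measure_cong)
    have "(\<integral>\<^sup>+y. ?G (p, y) \<partial>?R) = (\<integral>\<^sup>+\<omega>. ?H (p, (I m \<omega>, U m \<omega>)) \<partial>M)"
    proof (subst nn_integral_distr[OF Y])
      show "(\<lambda>y. ?G (p, y)) \<in> borel_measurable ?R"
        using measurable_compose[where f = "\<lambda>y. y m", OF _ Hp, of ?S'] by simp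
    qed simp
    also have "\<dots> = (\<integral>\<^sup>+y. ?H (p, y) \<partial>distr M S (\<lambda>\<omega>. (I m \<omega>, U m \<omega>)))"
      using Hp by (subst nn_integral_distr) auto
    also have "\<dots> = (\<integral>\<^sup>+i. \<integral>\<^sup>+v. c i * F (p, v) \<partial>?B \<partial>?A)"
      unfolding distr by (subst B.nn_integral_fst[symmetric, OF Hp']) simp
    also have "\<dots> = (\<integral>\<^sup>+i. c i * (\<integral>\<^sup>+v. F (p, v) \<partial>?B) \<partial>?A)"
      by (simp add: nn_integral_cmult)
    also have "\<dots> = (\<integral>\<^sup>+i. c i \<partial>?A) * (\<integral>\<^sup>+v. F (p, v) \<partial>?B)"
      by (simp add: nn_integral_multc)
    finally show "(\<integral>\<^sup>+y. ?G (p, y) \<partial>?R) = (\<integral>\<^sup>+i. c i \<partial>?A) * (\<integral>\<^sup>+v. F (p, v) \<partial>?B)" .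
  qed
  also have "\<dots> = (\<integral>\<^sup>+i. c i \<partial>?A) * (\<integral>\<^sup>+p. \<integral>\<^sup>+v. F (p, v) \<partial>?B \<partial>?Q)"
    by (rule nn_integral_cmult) (rule B.borel_measurable_nn_integral_fst, measurable)
  finally show ?thesis .
qed

lemma expectation_index_mult:
  fixes F :: "(nat \<Rightarrow> nat \<times> real) \<times> real \<Rightarrow> real"
  assumes F[measurable]: "F \<in> borel_measurable (past_space m \<Otimes>\<^sub>M lborel)"
    and int: "integrable M (\<lambda>\<omega>. F (past m \<omega>, U m \<omega>))" and nn: "\<And>x. 0 \<le> F x" and a: "a < n"
  shows "integrable M (\<lambda>\<omega>. indicator {a} (I m \<omega>) * F (past m \<omega>, U m \<omega>))"
    "expectation (\<lambda>\<omega>. indicator {a} (I m \<omega>) * F (past m \<omega>, U m \<omega>))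
      = expectation (\<lambda>\<omega>. F (past m \<omega>, U m \<omega>)) / n"
proof -
  show int': "integrable M (\<lambda>\<omega>. indicator {a} (I m \<omega>) * F (past m \<omega>, U m \<omega>))"
    by (rule Bochner_Integration.integrable_bound[OF int]) (auto simp: indicator_def)
  let ?E = "\<integral>\<^sup>+p. \<integral>\<^sup>+v. F (p, v) \<partial>uniform_measure lborel {-1<..<1} \<partial>distr M (past_space m) (past m)"
  have A: "(\<integral>\<^sup>+i. indicator {a} i \<partial>measure_pmf (pmf_of_set {..<n})) = ennreal (1 / n)"
    using a n by (simp add: emeasure_pmf_single pmf_of_set lessThan_empty_iff)
  have "ennreal (expectation (\<lambda>\<omega>. indicator {a} (I m \<omega>) * F (past m \<omega>, U m \<omega>)))
      = (\<integral>\<^sup>+\<omega>. ennreal (indicator {a} (I m \<omega>) * F (past m \<omega>, U m \<omega>)) \<partial>M)"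
    using nn by (intro nn_integral_eq_integral[symmetric] int') auto
  also have "\<dots> = (\<integral>\<^sup>+\<omega>. indicator {a} (I m \<omega>) * ennreal (F (past m \<omega>, U m \<omega>)) \<partial>M)"
    using nn by (intro nn_integral_cong) (auto simp: indicator_def)
  also have "\<dots> = ennreal (1 / n) * ?E"
    by (subst nn_integral_index_mult[where F = "\<lambda>x. ennreal (F x)"]) (simp_all add: A)
  \<comment> \<open>The same factorisation with constant weight 1 identifies the double integral as
    the expectation of \<open>F\<close>.\<close>
  also have "?E = (\<integral>\<^sup>+\<omega>. 1 * ennreal (F (past m \<omega>, U m \<omega>)) \<partial>M)"
    by (subst nn_integral_index_mult[where c = "\<lambda>_. 1" and F = "\<lambda>x. ennreal (F x)"]) simp_all
  also have "\<dots> = ennreal (expectation (\<lambda>\<omega>. F (past m \<omega>, U m \<omega>)))"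
    using nn int by (simp add: nn_integral_eq_integral)
  finally have "ennreal (expectation (\<lambda>\<omega>. indicator {a} (I m \<omega>) * F (past m \<omega>, U m \<omega>)))
      = ennreal (1 / n) * ennreal (expectation (\<lambda>\<omega>. F (past m \<omega>, U m \<omega>)))" .
  then show "expectation (\<lambda>\<omega>. indicator {a} (I m \<omega>) * F (past m \<omega>, U m \<omega>))
      = expectation (\<lambda>\<omega>. F (past m \<omega>, U m \<omega>)) / n"
    using nn by (subst (asm) ennreal_mult[symmetric])
      (auto simp: ennreal_inj intro!: Bochner_Integration.integral_nonneg)
qed

section \<open>The process as random variables, with bounds and measurability\<close>

definition h :: "nat \<Rightarrow> 'w \<Rightarrow> real" where
  "h m \<omega> = dsms_h hmin hmax \<nu> h1 (\<lambda>j. U j \<omega>) m"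

definition X :: "nat \<Rightarrow> 'w \<Rightarrow> nat \<Rightarrow> 'a" where
  "X m \<omega> = dsms_x k' n hmin hmax \<nu> h1 X0 (\<lambda>j. I j \<omega>) (\<lambda>j. U j \<omega>) m"

text \<open>The displacement that point \<open>a\<close> would undergo at step \<open>m\<close> if
  it were drawn, whether or not it is.\<close>

definition disp :: "nat \<Rightarrow> nat \<Rightarrow> 'w \<Rightarrow> real" where
  "disp a m \<omega> = dist (mean_shift k' n (h m \<omega>) (X m \<omega> a) (X m \<omega>)) (X m \<omega> a)"

text \<open>The coefficient of \<open>U (Suc m)\<close> in the tangent estimate for the energy when
  the bandwidth changes from \<open>g\<close> to its successor: the derivative in the scale, times
  the change of scale per unit of the draw.\<close>

definition energy_slope :: "nat \<Rightarrow> real \<Rightarrow> (nat \<Rightarrow> 'a) \<Rightarrow> real" where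
  "energy_slope m g Y = (1/g\<^sup>2) * dsms_delta hmin hmax (\<nu> (Suc m)) g *
     (\<Sum>a<n. \<Sum>b<n. k' ((1/g\<^sup>2) * (dist (Y a) (Y b))\<^sup>2) * (dist (Y a) (Y b))\<^sup>2)"

text \<open>A crude bound on the initial norms, which by the invariance of balls bounds all later
  states too.\<close>

definition B :: real where "B = (\<Sum>a<n. norm (X0 a))"

lemma X_Suc: "X (Suc m) \<omega> = (X m \<omega>)(I m \<omega> := mean_shift k' n (h m \<omega>) (X m \<omega> (I m \<omega>)) (X m \<omega>))"
  by (simp add: X_def h_def Let_def)

lemma norm_X_le: "a < n \<Longrightarrow> norm (X m \<omega> a) \<le> B"
  unfolding X_def
  by (rule norm_dsms_x_le[OF prof]) (auto simp: B_def intro!: member_le_sum)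

lemma dist_X_le:
  assumes "a < n" "b < n"
  shows "dist (X m \<omega> a) (X m \<omega> b) \<le> 2 * B"
  using norm_triangle_ineq4[of "X m \<omega> a" "X m \<omega> b"] norm_X_le[OF assms(1), of m \<omega>] norm_X_le[OF assms(2), of m \<omega>]
  by (simp add: dist_norm)

lemma disp_nonneg: "0 \<le> disp a m \<omega>"
  by (simp add: disp_def)

lemma disp_le:
  assumes "a < n"
  shows "disp a m \<omega> \<le> 2 * B"
proof -
  have "norm (mean_shift k' n (h m \<omega>) (X m \<omega> a) (X m \<omega>)) \<le> B"
    by (rule norm_mean_shift_le[OF prof assms]) (rule norm_X_le)
  then show ?thesis
    using norm_triangle_ineq4[of "mean_shift k' n (h m \<omega>) (X m \<omega> a) (X m \<omega>)" "X m \<omega> a"] norm_X_le[OF assms, of m \<omega>]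
    by (simp add: disp_def dist_norm)
qed

lemma h_bounds:
  assumes "\<forall>j. \<bar>U j \<omega>\<bar> < 1"
  shows "hmin \<le> h m \<omega>" "h m \<omega> \<le> hmax"
  unfolding h_def using assms hpos h1 nu_nonneg by (auto intro!: dsms_h_bounds)

lemma measurable_h[measurable]: "h m \<in> borel_measurable M"
  unfolding h_def[abs_def] by (rule borel_measurable_dsms_h) measurable

lemma measurable_X[measurable]: "(\<lambda>\<omega>. X m \<omega> a) \<in> borel_measurable M"
  unfolding X_def by (rule borel_measurable_dsms_x[OF prof]) measurable

lemma measurable_disp[measurable]: "disp a m \<in> borel_measurable M"
proof -
  have [measurable]: "(\<lambda>\<omega>. mean_shift k' n (h m \<omega>) (X m \<omega> a) (X m \<omega>)) \<in> borel_measurable M"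
    by (rule borel_measurable_mean_shift[OF prof]) measurable
  show ?thesis unfolding disp_def[abs_def] by measurable
qed

section \<open>Energy increments in expectation\<close>

lemma integrable_disp: "a < n \<Longrightarrow> integrable M (\<lambda>\<omega>. (disp a m \<omega>)\<^sup>2)"
  using power_mono[OF disp_le disp_nonneg, of a m _ 2]
  by (intro integrable_const_bound[where B = "(2 * B)\<^sup>2"]) auto

lemma integrable_energy: "integrable M (\<lambda>\<omega>. energy k n (1 / (h m \<omega>)\<^sup>2) (X m' \<omega>))"
proof (rule integrable_const_bound[where B = "(real n)\<^sup>2 * k 0"])
  show "(\<lambda>\<omega>. energy k n (1 / (h m \<omega>)\<^sup>2) (X m' \<omega>)) \<in> borel_measurable M"
    by (rule borel_measurable_energy[OF prof]) auto
  show "AE \<omega> in M. norm (energy k n (1 / (h m \<omega>)\<^sup>2) (X m' \<omega>)) \<le> (real n)\<^sup>2 * k 0"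
    by (simp add: energy_nonneg[OF prof] energy_le[OF prof])
qed

lemma energy_slope_bounded:
  assumes "\<forall>j. \<bar>U j \<omega>\<bar> < 1"
  shows "\<bar>energy_slope m (h m \<omega>) (X m' \<omega>)\<bar> \<le> (1 / hmin\<^sup>2) * 1 * (\<Sum>a<n. \<Sum>b<n. (- k' 0) * (2 * B)\<^sup>2)"
proof -
  note hb = h_bounds[OF assms, of m]
  have "\<bar>\<Sum>a<n. \<Sum>b<n. k' ((1/(h m \<omega>)\<^sup>2) * (dist (X m' \<omega> a) (X m' \<omega> b))\<^sup>2) * (dist (X m' \<omega> a) (X m' \<omega> b))\<^sup>2\<bar>
      \<le> (\<Sum>a<n. \<Sum>b<n. (- k' 0) * (2 * B)\<^sup>2)"
  proof (intro order_trans[OF sum_abs] sum_mono)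
    fix a b assume ab: "a \<in> {..<n}" "b \<in> {..<n}"
    have "0 \<le> (1/(h m \<omega>)\<^sup>2) * (dist (X m' \<omega> a) (X m' \<omega> b))\<^sup>2" by simp
    then have "\<bar>k' ((1/(h m \<omega>)\<^sup>2) * (dist (X m' \<omega> a) (X m' \<omega> b))\<^sup>2)\<bar> \<le> - k' 0"
      using profile_deriv_nonpos[OF prof] profile_deriv_mono[OF prof, of 0] by (simp add: abs_of_nonpos)
    then show "\<bar>k' ((1/(h m \<omega>)\<^sup>2) * (dist (X m' \<omega> a) (X m' \<omega> b))\<^sup>2) * (dist (X m' \<omega> a) (X m' \<omega> b))\<^sup>2\<bar>
        \<le> (- k' 0) * (2 * B)\<^sup>2"
      using ab dist_X_le[of a b m' \<omega>] power_mono[of "dist (X m' \<omega> a) (X m' \<omega> b)" "2 * B" 2] unfolding abs_mult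
      by (intro mult_mono) auto
  qed
  moreover have "\<bar>1/(h m \<omega>)\<^sup>2\<bar> \<le> 1 / hmin\<^sup>2"
    using hb hpos by (auto intro!: divide_left_mono power_mono mult_pos_pos)
  moreover have "\<bar>dsms_delta hmin hmax (\<nu> (Suc m)) (h m \<omega>)\<bar> \<le> 1"
    using dsms_delta_bounds(1,2)[OF hpos(1) hb nu_nonneg] by simp
  ultimately show ?thesis
    unfolding energy_slope_def abs_mult using hpos
    by (intro mult_mono) auto
qed

lemma borel_measurable_energy_slope:
  assumes [measurable]: "g \<in> borel_measurable N" "\<And>a. (\<lambda>x. Y x a) \<in> borel_measurable N"
  shows "(\<lambda>x. energy_slope m (g x) (Y x)) \<in> borel_measurable N"
proof -
  have [measurable]: "(\<lambda>x. k' ((1/(g x)\<^sup>2) * (dist (Y x a) (Y x b))\<^sup>2)) \<in> borel_measurable N" for a b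
    by (rule borel_measurable_continuous_nonneg[OF profile_continuous_on(2)[OF prof]]) auto
  show ?thesis
    unfolding energy_slope_def dsms_delta_def by measurable
qed

text \<open>The slope involves bandwidth \<open>m\<close> and state \<open>Suc m\<close>, both
  determined by the draws up to step \<open>m\<close>, while \<open>U (Suc m)\<close> is independent
  of these and centred.\<close>

lemma expectation_energy_slope:
  "integrable M (\<lambda>\<omega>. energy_slope m (h m \<omega>) (X (Suc m) \<omega>) * U (Suc m) \<omega>)"
  "expectation (\<lambda>\<omega>. energy_slope m (h m \<omega>) (X (Suc m) \<omega>) * U (Suc m) \<omega>) = 0"
proof -
  \<comment> \<open>The same slope recomputed from a recorded past, hence a measurable function on
    the product space.\<close>
  define F where "F p = energy_slope m (dsms_h hmin hmax \<nu> h1 (\<lambda>j. snd (p j)) m)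
      (dsms_x k' n hmin hmax \<nu> h1 X0 (\<lambda>j. fst (p j)) (\<lambda>j. snd (p j)) (Suc m))" for p :: "nat \<Rightarrow> nat \<times> real"
  have comp: "(\<lambda>p. p j) \<in> measurable (past_space (Suc m)) S" if "j < Suc m" for j
    using that by (intro measurable_component_singleton) simp
  have comp': "(\<lambda>p. fst (p j)) \<in> measurable (past_space (Suc m)) (count_space UNIV)"
    "(\<lambda>p. snd (p j)) \<in> borel_measurable (past_space (Suc m))" if "j < Suc m" for j
    using measurable_compose[OF comp[OF that] measurable_fst]
      measurable_compose[OF comp[OF that] measurable_snd] by simp_all
  have F: "F \<in> borel_measurable (past_space (Suc m))"
    unfolding F_def[abs_def]
    by (intro borel_measurable_energy_slope borel_measurable_dsms_h borel_measurable_dsms_x[OF prof] comp') auto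
  have eq: "energy_slope m (h m \<omega>) (X (Suc m) \<omega>) = F (past (Suc m) \<omega>)" for \<omega>
  proof -
    have "h m \<omega> = dsms_h hmin hmax \<nu> h1 (\<lambda>j. snd (past (Suc m) \<omega> j)) m"
      unfolding h_def by (rule dsms_h_cong) (simp add: past_def)
    moreover have "X (Suc m) \<omega> = dsms_x k' n hmin hmax \<nu> h1 X0 (\<lambda>j. fst (past (Suc m) \<omega> j)) (\<lambda>j. snd (past (Suc m) \<omega> j)) (Suc m)"
      unfolding X_def by (rule dsms_x_cong) (simp_all add: past_def)
    ultimately show ?thesis by (simp only: F_def)
  qed
  have "integrable M (\<lambda>\<omega>. F (past (Suc m) \<omega>))"
  proof (rule integrable_const_bound)
    show "AE \<omega> in M. norm (F (past (Suc m) \<omega>)) \<le> (1 / hmin\<^sup>2) * 1 * (\<Sum>a<n. \<Sum>b<n. (- k' 0) * (2 * B)\<^sup>2)"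
      using AE_U by eventually_elim (use energy_slope_bounded in \<open>simp add: eq[symmetric]\<close>)
    show "(\<lambda>\<omega>. F (past (Suc m) \<omega>)) \<in> borel_measurable M"
      by (rule measurable_compose[OF measurable_past F])
  qed
  from expectation_past_mult_U[OF F this]
  show "integrable M (\<lambda>\<omega>. energy_slope m (h m \<omega>) (X (Suc m) \<omega>) * U (Suc m) \<omega>)"
    "expectation (\<lambda>\<omega>. energy_slope m (h m \<omega>) (X (Suc m) \<omega>) * U (Suc m) \<omega>) = 0"
    by (simp_all add: eq)
qed

text \<open>The energy lies above its tangent in the scale, and the linear term has mean 0; in
  effect this is Jensen's inequality for the centred random factor.\<close>

lemma expectation_bandwidth_step:
  "expectation (\<lambda>\<omega>. energy k n (1 / (h m \<omega>)\<^sup>2) (X (Suc m) \<omega>))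
    \<le> expectation (\<lambda>\<omega>. energy k n (1 / (h (Suc m) \<omega>)\<^sup>2) (X (Suc m) \<omega>))"
proof -
  have "expectation (\<lambda>\<omega>. energy k n (1 / (h m \<omega>)\<^sup>2) (X (Suc m) \<omega>)) =
      expectation (\<lambda>\<omega>. energy k n (1 / (h m \<omega>)\<^sup>2) (X (Suc m) \<omega>) + energy_slope m (h m \<omega>) (X (Suc m) \<omega>) * U (Suc m) \<omega>)"
    by (simp add: expectation_energy_slope integrable_energy)
  also have "\<dots> \<le> expectation (\<lambda>\<omega>. energy k n (1 / (h (Suc m) \<omega>)\<^sup>2) (X (Suc m) \<omega>))"
  proof (rule integral_mono_AE)
    show "AE \<omega> in M. energy k n (1 / (h m \<omega>)\<^sup>2) (X (Suc m) \<omega>) + energy_slope m (h m \<omega>) (X (Suc m) \<omega>) * U (Suc m) \<omega>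
        \<le> energy k n (1 / (h (Suc m) \<omega>)\<^sup>2) (X (Suc m) \<omega>)"
      using AE_U
    proof eventually_elim
      case (elim \<omega>)
      have "1 / (h (Suc m) \<omega>)\<^sup>2 = (1 / (h m \<omega>)\<^sup>2) * (1 + dsms_delta hmin hmax (\<nu> (Suc m)) (h m \<omega>) * U (Suc m) \<omega>)"
        unfolding h_def
        by (rule inverse_square_dsms_h_Suc[where u = "\<lambda>j. U j \<omega>"]) (use hpos h1 nu_nonneg elim in auto)
      then have "1 / (h (Suc m) \<omega>)\<^sup>2 - 1 / (h m \<omega>)\<^sup>2 =
          (1 / (h m \<omega>)\<^sup>2) * dsms_delta hmin hmax (\<nu> (Suc m)) (h m \<omega>) * U (Suc m) \<omega>"
        by (simp only: ring_distribs mult_1_right mult.assoc add_diff_cancel_left')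
      moreover have "energy k n (1 / (h m \<omega>)\<^sup>2) (X (Suc m) \<omega>) + (1 / (h (Suc m) \<omega>)\<^sup>2 - 1 / (h m \<omega>)\<^sup>2) *
          (\<Sum>a<n. \<Sum>b<n. k' ((1 / (h m \<omega>)\<^sup>2) * (dist (X (Suc m) \<omega> a) (X (Suc m) \<omega> b))\<^sup>2) * (dist (X (Suc m) \<omega> a) (X (Suc m) \<omega> b))\<^sup>2)
          \<le> energy k n (1 / (h (Suc m) \<omega>)\<^sup>2) (X (Suc m) \<omega>)"
        by (rule energy_above_tangent[OF prof]) auto
      ultimately show ?case
        by (simp only: energy_slope_def mult_ac)
    qed
  qed (auto intro: integrable_energy expectation_energy_slope(1))
  finally show ?thesis .
qed

text \<open>The would-be displacement is a function of the past and of \<open>U m\<close>, hence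
  independent of the index drawn at step \<open>m\<close>.\<close>

lemma expectation_index_disp:
  assumes a: "a < n"
  shows "integrable M (\<lambda>\<omega>. indicator {a} (I m \<omega>) * (disp a m \<omega>)\<^sup>2)"
    "expectation (\<lambda>\<omega>. indicator {a} (I m \<omega>) * (disp a m \<omega>)\<^sup>2) = expectation (\<lambda>\<omega>. (disp a m \<omega>)\<^sup>2) / n"
proof -
  \<comment> \<open>Bandwidth \<open>m\<close> reads the draws up to and including \<open>m\<close>;
    the second component of \<open>x\<close> supplies the one at \<open>m\<close>.\<close>
  define hf where "hf x = dsms_h hmin hmax \<nu> h1 (\<lambda>j. if j < m then snd (fst x j) else snd x) m"
    for x :: "(nat \<Rightarrow> nat \<times> real) \<times> real"
  define Xf where "Xf x = dsms_x k' n hmin hmax \<nu> h1 X0 (\<lambda>j. fst (fst x j)) (\<lambda>j. snd (fst x j)) m"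
    for x :: "(nat \<Rightarrow> nat \<times> real) \<times> real"
  define F where "F x = (dist (mean_shift k' n (hf x) (Xf x a) (Xf x)) (Xf x a))\<^sup>2" for x
  let ?N = "past_space m \<Otimes>\<^sub>M lborel :: ((nat \<Rightarrow> nat \<times> real) \<times> real) measure"
  have comp: "(\<lambda>x. fst x j) \<in> measurable ?N S" if "j < m" for j
    using that by (intro measurable_compose[OF measurable_fst measurable_component_singleton]) simp
  have comp': "(\<lambda>x. fst (fst x j)) \<in> measurable ?N (count_space UNIV)"
    "(\<lambda>x. snd (fst x j)) \<in> borel_measurable ?N" if "j < m" for j
    using measurable_compose[OF comp[OF that] measurable_fst]
      measurable_compose[OF comp[OF that] measurable_snd] by simp_all
  have hf: "hf \<in> borel_measurable ?N"
    unfolding hf_def[abs_def]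
  proof (rule borel_measurable_dsms_h)
    fix j
    show "(\<lambda>x. if j < m then snd (fst x j) else snd x) \<in> borel_measurable ?N"
      using comp'(2)[of j] by (cases "j < m") auto
  qed
  have Xf: "(\<lambda>x. Xf x b) \<in> borel_measurable ?N" for b
    unfolding Xf_def by (intro borel_measurable_dsms_x[OF prof] comp')
  have "F \<in> borel_measurable ?N"
    unfolding F_def[abs_def]
    by (intro borel_measurable_power borel_measurable_dist borel_measurable_mean_shift[OF prof] hf Xf)
  moreover have eq: "F (past m \<omega>, U m \<omega>) = (disp a m \<omega>)\<^sup>2" for \<omega>
  proof -
    have "h m \<omega> = hf (past m \<omega>, U m \<omega>)"
      unfolding h_def hf_def by (rule dsms_h_cong) (auto simp: past_def)
    moreover have "X m \<omega> = Xf (past m \<omega>, U m \<omega>)"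
      unfolding X_def Xf_def by (rule dsms_x_cong) (simp_all add: past_def)
    ultimately show ?thesis by (simp add: F_def disp_def)
  qed
  moreover have "0 \<le> F x" for x by (simp add: F_def)
  ultimately show "integrable M (\<lambda>\<omega>. indicator {a} (I m \<omega>) * (disp a m \<omega>)\<^sup>2)"
    "expectation (\<lambda>\<omega>. indicator {a} (I m \<omega>) * (disp a m \<omega>)\<^sup>2) = expectation (\<lambda>\<omega>. (disp a m \<omega>)\<^sup>2) / n"
    using expectation_index_mult[of F m a] integrable_disp[OF a] a by (simp_all add: eq)
qed

text \<open>The coefficient in the one-step energy estimate with \<open>1/h\<^sup>2\<close> replaced
  by its least value \<open>1/hmax\<^sup>2\<close>.\<close>

definition gain :: real where "gain = 2 * (1 / hmax\<^sup>2) * (- k' 0)"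

lemma gain_pos: "0 < gain"
proof -
  have "k' 0 < 0" using prof by (simp add: profile_def)
  then show ?thesis using hpos unfolding gain_def by (intro mult_pos_pos) auto
qed

text \<open>Only the drawn point moves, and the energy rises by at least \<open>gain\<close> times
  its squared displacement. Averaging over the uniform index turns this into the mean over all
  would-be displacements.\<close>

lemma expectation_mean_shift_step:
  "expectation (\<lambda>\<omega>. energy k n (1 / (h m \<omega>)\<^sup>2) (X m \<omega>)) + gain / n * (\<Sum>a<n. expectation (\<lambda>\<omega>. (disp a m \<omega>)\<^sup>2))
    \<le> expectation (\<lambda>\<omega>. energy k n (1 / (h m \<omega>)\<^sup>2) (X (Suc m) \<omega>))"
proof -
  let ?J = "\<lambda>\<omega>. \<Sum>a<n. indicator {a} (I m \<omega>) * (disp a m \<omega>)\<^sup>2"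
  have int: "integrable M ?J"
    using expectation_index_disp(1) by (intro Bochner_Integration.integrable_sum) auto
  have "expectation ?J = (\<Sum>a<n. expectation (\<lambda>\<omega>. (disp a m \<omega>)\<^sup>2) / n)"
    using expectation_index_disp by (subst Bochner_Integration.integral_sum) auto
  then have "expectation (\<lambda>\<omega>. energy k n (1 / (h m \<omega>)\<^sup>2) (X m \<omega>)) + gain / n * (\<Sum>a<n. expectation (\<lambda>\<omega>. (disp a m \<omega>)\<^sup>2))
      = expectation (\<lambda>\<omega>. energy k n (1 / (h m \<omega>)\<^sup>2) (X m \<omega>)) + gain * expectation ?J"
    by (simp only: sum_divide_distrib[symmetric]) simp
  also have "\<dots> = expectation (\<lambda>\<omega>. energy k n (1 / (h m \<omega>)\<^sup>2) (X m \<omega>) + gain * ?J \<omega>)"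
    using int integrable_energy by simp
  also have "\<dots> \<le> expectation (\<lambda>\<omega>. energy k n (1 / (h m \<omega>)\<^sup>2) (X (Suc m) \<omega>))"
  proof (rule integral_mono_AE)
    show "AE \<omega> in M. energy k n (1 / (h m \<omega>)\<^sup>2) (X m \<omega>) + gain * ?J \<omega> \<le> energy k n (1 / (h m \<omega>)\<^sup>2) (X (Suc m) \<omega>)"
      using AE_U
    proof eventually_elim
      case (elim \<omega>)
      show ?case
      proof (cases "I m \<omega> < n")
        case True
        have "?J \<omega> = (\<Sum>a<n. if a = I m \<omega> then (disp a m \<omega>)\<^sup>2 else 0)"
          by (intro sum.cong) (auto simp: indicator_def)
        then have "?J \<omega> = (disp (I m \<omega>) m \<omega>)\<^sup>2" using True by simp
        moreover have "gain * (disp (I m \<omega>) m \<omega>)\<^sup>2 \<le> 2 * (1 / (h m \<omega>)\<^sup>2) * (- k' 0) * (disp (I m \<omega>) m \<omega>)\<^sup>2"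
          unfolding gain_def using h_bounds[OF elim, of m] hpos profile_deriv_nonpos[OF prof, of 0]
          by (intro mult_right_mono mult_left_mono divide_left_mono power_mono mult_pos_pos) auto
        moreover have "energy k n (1 / (h m \<omega>)\<^sup>2) (X m \<omega>)
            + 2 * (1 / (h m \<omega>)\<^sup>2) * (- k' 0) * (disp (I m \<omega>) m \<omega>)\<^sup>2
            \<le> energy k n (1 / (h m \<omega>)\<^sup>2) (X (Suc m) \<omega>)"
          unfolding X_Suc disp_def by (rule energy_mean_shift_ge[OF prof True])
        ultimately show ?thesis by (simp only:)
      next
        case False
        then have "?J \<omega> = 0" by (intro sum.neutral) auto
        \<comment> \<open>An index outside the range moves a point that the energy does not see, so
          the estimate holds in this null case as well.\<close>
        moreover have "energy k n (1 / (h m \<omega>)\<^sup>2) (X (Suc m) \<omega>) = energy k n (1 / (h m \<omega>)\<^sup>2) (X m \<omega>)"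
          unfolding energy_def X_Suc using False by (intro sum.cong refl) auto
        ultimately show ?thesis by simp
      qed
    qed
  qed (intro Bochner_Integration.integrable_add integrable_mult_right integrable_energy int)+
  finally show ?thesis .
qed

text \<open>The combined effect of a mean-shift step and a bandwidth step telescopes, and the
  expected energy stays between 0 and \<open>(real n)\<^sup>2 * k 0\<close>.\<close>

lemma sum_expectation_disp_le:
  "gain / n * (\<Sum>m<K. \<Sum>a<n. expectation (\<lambda>\<omega>. (disp a m \<omega>)\<^sup>2)) \<le> (real n)\<^sup>2 * k 0"
proof -
  define e where "e m = expectation (\<lambda>\<omega>. energy k n (1 / (h m \<omega>)\<^sup>2) (X m \<omega>))" for m
  have step: "e m + gain / n * (\<Sum>a<n. expectation (\<lambda>\<omega>. (disp a m \<omega>)\<^sup>2)) \<le> e (Suc m)" for m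
    unfolding e_def using expectation_mean_shift_step[of m] expectation_bandwidth_step[of m] by linarith
  have "e 0 + gain / n * (\<Sum>m<K. \<Sum>a<n. expectation (\<lambda>\<omega>. (disp a m \<omega>)\<^sup>2)) \<le> e K"
  proof (induction K)
    case (Suc K)
    then show ?case using step[of K] unfolding sum.lessThan_Suc distrib_left by linarith
  qed simp
  moreover have "0 \<le> e 0"
    unfolding e_def by (intro Bochner_Integration.integral_nonneg energy_nonneg[OF prof]) simp
  moreover have "e K \<le> expectation (\<lambda>_. (real n)\<^sup>2 * k 0)"
    unfolding e_def by (intro integral_mono integrable_energy energy_le[OF prof]) auto
  ultimately show ?thesis by (simp add: prob_space)
qed

section \<open>Almost sure conclusions\<close>

lemma AE_disp_tendsto_0:
  assumes a: "a < n"
  shows "AE \<omega> in M. (\<lambda>m. disp a m \<omega>) \<longlonglongrightarrow> 0"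
proof -
  have "AE \<omega> in M. (\<lambda>m. (disp a m \<omega>)\<^sup>2) \<longlonglongrightarrow> 0"
  proof (rule AE_tendsto_0_of_bounded_integrals[OF integrable_disp[OF a]])
    fix K
    have "(\<Sum>m<K. expectation (\<lambda>\<omega>. (disp a m \<omega>)\<^sup>2)) \<le> (\<Sum>m<K. \<Sum>a<n. expectation (\<lambda>\<omega>. (disp a m \<omega>)\<^sup>2))"
      using a by (intro sum_mono member_le_sum[where f = "\<lambda>a. expectation (\<lambda>\<omega>. (disp a _ \<omega>)\<^sup>2)"]) auto
    also have "\<dots> \<le> (real n)\<^sup>2 * k 0 / (gain / n)"
      using sum_expectation_disp_le[of K] gain_pos n by (subst pos_le_divide_eq) (auto simp: mult.commute)
    finally show "(\<Sum>m<K. expectation (\<lambda>\<omega>. (disp a m \<omega>)\<^sup>2)) \<le> (real n)\<^sup>2 * k 0 / (gain / n)" .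
  qed simp
  then show ?thesis
  proof eventually_elim
    case (elim \<omega>)
    from tendsto_real_sqrt[OF elim] show ?case by (simp add: disp_def)
  qed
qed

text \<open>On the almost sure event that all draws lie in the open interval and all would-be
  displacements tend to 0, the deterministic results on near and far pairs apply path by
  path.\<close>

lemma AE_clusters_stabilize:
  assumes "0 < \<tau>"
  shows "AE \<omega> in M. \<exists>Ps. partition_on {..<n} Ps \<and>
        (\<exists>K. \<forall>j\<ge>K. (\<forall>J\<in>Ps. \<forall>a\<in>J. \<forall>b\<in>J. dist (X j \<omega> a) (X j \<omega> b) < \<tau>) \<and>
           (\<forall>J\<in>Ps. \<forall>J'\<in>Ps. J \<noteq> J' \<longrightarrow> (\<forall>a\<in>J. \<forall>b\<in>J'. dist (X j \<omega> a) (X j \<omega> b) > hmin - \<tau>))) \<and>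
        (\<forall>J\<in>Ps. (\<lambda>j. diameter (X j \<omega> ` J)) \<longlonglongrightarrow> 0)"
proof -
  have "AE \<omega> in M. \<forall>a\<in>{..<n}. (\<lambda>m. disp a m \<omega>) \<longlonglongrightarrow> 0"
    using AE_disp_tendsto_0 by (intro AE_finite_allI) auto
  with AE_U show ?thesis
  proof eventually_elim
    case (elim \<omega>)
    show ?case
    proof (rule clusters_stabilize[OF hpos(1) assms])
      show "\<forall>\<^sub>F j in sequentially. \<forall>a<n. \<forall>b<n.
          dist (X j \<omega> a) (X j \<omega> b) < \<epsilon> \<or> hmin - \<epsilon> < dist (X j \<omega> a) (X j \<omega> b)"
        if "0 < \<epsilon>" "\<epsilon> < hmin" for \<epsilon>
        using elim(2) that
        by (intro eventually_near_or_far[OF prof hpos(1) h_bounds(1)[OF elim(1)] norm_X_le])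
           (auto simp: disp_def)
      show "(\<lambda>j. dist (X (Suc j) \<omega> a) (X j \<omega> a)) \<longlonglongrightarrow> 0" if "a < n" for a
      \<comment> \<open>The actual displacement of \<open>a\<close> is either 0 or its would-be
        displacement.\<close>
      proof (rule tendsto_sandwich[of "\<lambda>_. 0" _ _ "\<lambda>m. disp a m \<omega>"])
        show "(\<lambda>m. disp a m \<omega>) \<longlonglongrightarrow> 0" using elim(2) that by auto
      qed (auto simp: X_Suc disp_def)
    qed
  qed
qed

end

theorem theorem2:
  fixes k k' :: "real \<Rightarrow> real"
    and n :: nat and hmin hmax h1 \<tau> :: real
    and \<nu> :: "nat \<Rightarrow> real"
    and X0 :: "nat \<Rightarrow> 'a::euclidean_space"
    and M :: "'w measure"
    and I :: "nat \<Rightarrow> 'w \<Rightarrow> nat" and U :: "nat \<Rightarrow> 'w \<Rightarrow> real"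
  assumes prof: "profile k k'"
    and n: "n \<ge> 1"
    and hpos: "0 < hmin" "hmin < hmax"
    and h1: "hmin \<le> h1" "h1 \<le> hmax"
    and nu_nonneg: "\<And>j. \<nu> j \<ge> 0"
    and nu_lim: "\<nu> \<longlonglongrightarrow> 0"
    and tau: "0 < \<tau>" "\<tau> < hmin / 2"
    and P: "prob_space M"
    and indep: "prob_space.indep_vars M (\<lambda>_. count_space UNIV \<Otimes>\<^sub>M lborel)
                   (\<lambda>j \<omega>. (I j \<omega>, U j \<omega>)) UNIV"
    and distr: "\<And>j. distr M (count_space UNIV \<Otimes>\<^sub>M lborel) (\<lambda>\<omega>. (I j \<omega>, U j \<omega>))
                   = measure_pmf (pmf_of_set {..<n}) \<Otimes>\<^sub>M uniform_measure lborel {-1<..<1}"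
  shows "AE \<omega> in M.
     (\<exists>Ps. partition_on {..<n} Ps \<and>
        (\<exists>K. \<forall>j\<ge>K.
           (\<forall>J\<in>Ps. \<forall>a\<in>J. \<forall>b\<in>J.
              dist (dsms_x k' n hmin hmax \<nu> h1 X0 (\<lambda>m. I m \<omega>) (\<lambda>m. U m \<omega>) j a)
                   (dsms_x k' n hmin hmax \<nu> h1 X0 (\<lambda>m. I m \<omega>) (\<lambda>m. U m \<omega>) j b) < \<tau>) \<and>
           (\<forall>J\<in>Ps. \<forall>J'\<in>Ps. J \<noteq> J' \<longrightarrow> (\<forall>a\<in>J. \<forall>b\<in>J'.
              dist (dsms_x k' n hmin hmax \<nu> h1 X0 (\<lambda>m. I m \<omega>) (\<lambda>m. U m \<omega>) j a)
                   (dsms_x k' n hmin hmax \<nu> h1 X0 (\<lambda>m. I m \<omega>) (\<lambda>m. U m \<omega>) j b) > hmin - \<tau>))) \<and>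
        (\<forall>J\<in>Ps. (\<lambda>j. diameter
              ((dsms_x k' n hmin hmax \<nu> h1 X0 (\<lambda>m. I m \<omega>) (\<lambda>m. U m \<omega>) j) ` J))
              \<longlonglongrightarrow> 0))"
proof -
  interpret prob_space M by (rule P)
  interpret dsms M k k' n hmin hmax h1 \<nu> X0 I U
    by unfold_locales (use assms in auto)
  show ?thesis
    using AE_clusters_stabilize[OF tau(1)] unfolding X_def .
qed

end
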